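(* Consider the single index volatility model $y=f(\langle x,\beta^\star\rangle)+g(\langle x,\gamma^\star\rangle)\epsilon$. Suppose the functions $x\mapsto f^2(\langle x,\beta^\star\rangle)$ and $x\mapsto g^2(\langle x,\gamma^\star\rangle)$ together with $x$ satisfy the first-order regularity condition, $\|\beta^\star\|_0\vee\|\gamma^\star\|_0\le s$, $\langle\beta^\star,\gamma^\star\rangle=0$, and $\mu_1=\mathbb{E}[g(\langle x,\gamma^\star\rangle)g'(\langle x,\gamma^\star\rangle)]\ne0$. Suppose the finite $p$-th moment assumption holds with $p\ge6$, and that $\hat\beta$ is an estimator of $\beta^\star$ which for any $0<\delta<1$ satisfies, with probability at least $1-\delta$, $$\|\hat\beta-\beta^\star\|_2\lesssim\sqrt{\tfrac{s\log(d/\delta)}{n}},\quad\|\hat\beta-\beta^\star\|_1\lesssim s\sqrt{\tfrac{\log(d/\delta)}{n}},\quad\|\hat\beta-\beta^\star\|_\infty\lesssim\sqrt{\tfrac{\log(d/\delta)}{n}} .$$ Let $\tilde\gamma=2\mu_1\gamma^\star$, $\eta_1=\mathbb{E}[f(x^T\beta^\star)f'(x^T\beta^\star)]$, and $$\bar w=\frac1n\sum_{i=1}^n\Psi_\tau(y_i)^2\,\Psi_\tau(S(x_i)),\qquad\hat w=\phi_\kappa(\bar w),\qquad\hat\gamma_5=\phi_\lambda\big(\bar w-\langle\hat\beta,\hat w\rangle\hat\beta\big).$$ Then for any $0<\delta<1$ there exists a constant $C_{(\eta_1,\mu_1,\|\beta^\star\|_1,\|\gamma^\star\|_1)}$ such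 that $\hat\gamma_5$ with $\tau=\big(\frac{nM_6}{\log(2d/\delta)}\big)^{1/6}$, $\kappa=14\sqrt{\frac{M_6\log(2d/\delta)}{n}}$ and $\lambda\ge C_{(\eta_1,\mu_1,\|\beta^\star\|_1,\|\gamma^\star\|_1)}\,\kappa$ satisfies $$P\big(\|\hat\gamma_5-\tilde\gamma\|_2\le3\sqrt s\,\lambda\ \text{ and }\ \|\hat\gamma_5-\tilde\gamma\|_1\le12s\lambda\big)\ge1-\delta .$$
   Context: Model: $x\in\mathbb{R}^d$ is random with density $p_x$; $\epsilon$ is independent of $x$, $\mathbb{E}\epsilon=0$, $\mathbb{E}\epsilon^2=1$; $f,g:\mathbb{R}\to\mathbb{R}$ are unknown; $\beta^\star,\gamma^\star\in\mathbb{R}^d$ are unit vectors; $\|v\|_0$ is the number of nonzero entries. $\{(y_i,x_i)\}_{i=1}^n$ are i.i.d. samples from the model, independent of the sample (of size $n$) used to compute $\hat\beta$. First-order regularity condition: $x$ has a differentiable density $p_x$ with support $\mathcal{X}\subseteq\mathbb{R}^d$, strictly positive in the interior of $\mathcal{X}$, with $|p_x(u)|\to0$ as $u$ goes to the boundary; the first-order score is $S(u)=-\nabla\log p_x(u)\in\mathbb{R}^d$. A differentiable $\phi:\mathcal{X}\to\mathbb{R}$ together with $x$ satisfies the condition if $\mathbb{E}|\phi(x)S(x)|$ and $\mathbb{E}|\nabla\phi(x)|$ exist. The second-order score is $H(u)=\nabla^2p_x(u)/p_x(u)$. Finite $p$-th moment assumption: $\mathbb{E}|\epsilon|^p<\infty$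 (regarded as a constant) and there is a constant $M_p>0$ with $\mathbb{E}|x^Tv|^p\vee\mathbb{E}|f(x^T\beta^\star)|^p\vee\mathbb{E}|g(x^T\gamma^\star)|^p\vee\mathbb{E}|S(x)_j|^p\vee\mathbb{E}|H(x)_{jk}|^p\le M_p$ for all $j,k\in[d]$ and all unit $v\in\mathbb{R}^d$; furthermore $\mathbb{E}|y|^p\lesssim M_p$. $\Psi_\tau(v)=v\,\mathbf{1}\{|v|\le\tau\}$ and $\phi_\lambda(v)=(1-\lambda/|v|)_+\,v$ (soft-thresholding), both applied elementwise. $a\lesssim b$ means $a\le cb$ for a constant $c$. The subscript of the constant $C$ lists the model quantities on which it depends.
   Formalization: M_6 is required to satisfy E|y|^6 ≤ M_6 (implicit constant 1 instead of ≲); with a large implicit constant the claim fails for the stated κ when d and s are large compared with n. Every model satisfying the assumption has such an M_6. *)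

theory Defs
  imports "HOL-Probability.Probability"
begin

text \<open>
  The dimension \<open>d\<close> is a number, not a type: the constant of the theorem may not depend on \<open>d\<close>,
  so \<open>d\<close> is quantified inside the statement.  A vector of $d$-dimensional space is a function
  \<open>nat \<Rightarrow> real\<close> of which only the values below \<open>d\<close> matter.  As a topological space and as a
  measurable space, $d$-dimensional space is \<open>\<Pi>\<^sub>E j\<in>{..<d}. UNIV\<close> with the product topology
  and the product of the Borel (or Lebesgue-Borel) measures.
\<close>

subsection \<open>Vectors\<close>

abbreviation Rd_top :: "nat \<Rightarrow> (nat \<Rightarrow> real) topology"
  where "Rd_top d \<equiv> powertop_real {..<d}"

abbreviation Rd_borel :: "nat \<Rightarrow> (nat \<Rightarrow> real) measure"
  where "Rd_borel d \<equiv> PiM {..<d} (\<lambda>_. borel)"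

abbreviation Rd_lebesgue :: "nat \<Rightarrow> (nat \<Rightarrow> real) measure"
  where "Rd_lebesgue d \<equiv> PiM {..<d} (\<lambda>_. lborel)"

definition dot :: "nat \<Rightarrow> (nat \<Rightarrow> real) \<Rightarrow> (nat \<Rightarrow> real) \<Rightarrow> real"
  where "dot d u v = (\<Sum>j<d. u j * v j)"

definition norm0 :: "nat \<Rightarrow> (nat \<Rightarrow> real) \<Rightarrow> nat"
  where "norm0 d v = card {j. j < d \<and> v j \<noteq> 0}"

definition norm1 :: "nat \<Rightarrow> (nat \<Rightarrow> real) \<Rightarrow> real"
  where "norm1 d v = (\<Sum>j<d. \<bar>v j\<bar>)"

definition norm2 :: "nat \<Rightarrow> (nat \<Rightarrow> real) \<Rightarrow> real"
  where "norm2 d v = L2_set v {..<d}"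

definition norm_inf :: "nat \<Rightarrow> (nat \<Rightarrow> real) \<Rightarrow> real"
  where "norm_inf d v = Max ((\<lambda>j. \<bar>v j\<bar>) ` {..<d})"

subsection \<open>Differentiation\<close>

text \<open>Frechet differentiability at \<open>u\<close> relative to \<open>X\<close>, with gradient \<open>G\<close>.\<close>

definition has_gradient ::
  "nat \<Rightarrow> ((nat \<Rightarrow> real) \<Rightarrow> real) \<Rightarrow> (nat \<Rightarrow> real) \<Rightarrow> (nat \<Rightarrow> real) \<Rightarrow> (nat \<Rightarrow> real) set \<Rightarrow> bool"
  where "has_gradient d \<phi> G u X \<longleftrightarrow>
    ((\<lambda>v. (\<phi> v - \<phi> u - dot d G (\<lambda>j. v j - u j)) / norm2 d (\<lambda>j. v j - u j)) \<longlongrightarrow> 0)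
      (atin_within (Rd_top d) u X)"

definition partial_deriv :: "nat \<Rightarrow> ((nat \<Rightarrow> real) \<Rightarrow> real) \<Rightarrow> (nat \<Rightarrow> real) \<Rightarrow> real"
  where "partial_deriv j \<phi> u = deriv (\<lambda>t. \<phi> (u(j := t))) (u j)"

subsection \<open>Density, scores and the first-order regularity condition\<close>

definition density_support :: "nat \<Rightarrow> ((nat \<Rightarrow> real) \<Rightarrow> real) \<Rightarrow> (nat \<Rightarrow> real) set"
  where "density_support d p = Rd_top d closure_of {u. p u \<noteq> 0}"

definition support_interior :: "nat \<Rightarrow> ((nat \<Rightarrow> real) \<Rightarrow> real) \<Rightarrow> (nat \<Rightarrow> real) set"
  where "support_interior d p = Rd_top d interior_of density_support d p"

text \<open>
  Gradient and scores are determined only in the interior of the support of \<open>p\<close>.  They are set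
  to 0 elsewhere, which is a null set for the law of \<open>x\<close> because \<open>p\<close> vanishes at the boundary.
\<close>

definition gradient ::
  "nat \<Rightarrow> ((nat \<Rightarrow> real) \<Rightarrow> real) \<Rightarrow> ((nat \<Rightarrow> real) \<Rightarrow> real) \<Rightarrow> (nat \<Rightarrow> real) \<Rightarrow> nat \<Rightarrow> real"
  where "gradient d p \<phi> u j = (if u \<in> support_interior d p then partial_deriv j \<phi> u else 0)"

definition score1 :: "nat \<Rightarrow> ((nat \<Rightarrow> real) \<Rightarrow> real) \<Rightarrow> (nat \<Rightarrow> real) \<Rightarrow> nat \<Rightarrow> real"
  where "score1 d p u j = - gradient d p (\<lambda>v. ln (p v)) u j"

definition score2 :: "nat \<Rightarrow> ((nat \<Rightarrow> real) \<Rightarrow> real) \<Rightarrow> (nat \<Rightarrow> real) \<Rightarrow> nat \<Rightarrow> nat \<Rightarrow> real"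
  where "score2 d p u j k = gradient d p (\<lambda>v. gradient d p p v j) u k / p u"

definition first_order_regular ::
  "'w measure \<Rightarrow> nat \<Rightarrow> ((nat \<Rightarrow> real) \<Rightarrow> real) \<Rightarrow> ('w \<Rightarrow> nat \<Rightarrow> real) \<Rightarrow> ((nat \<Rightarrow> real) \<Rightarrow> real) \<Rightarrow> bool"
  where "first_order_regular M d p x \<phi> \<longleftrightarrow>
    (\<forall>u\<in>support_interior d p. p u > 0 \<and> (\<exists>G. has_gradient d p G u UNIV)) \<and>
    (\<forall>u\<in>Rd_top d frontier_of density_support d p.
        ((\<lambda>v. \<bar>p v\<bar>) \<longlongrightarrow> 0) (atin_within (Rd_top d) u (density_support d p))) \<and>
    (\<forall>u\<in>density_support d p. \<exists>G. has_gradient d \<phi> G u (density_support d p)) \<and>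
    integrable M (\<lambda>\<omega>. norm2 d (\<lambda>j. \<phi> (x \<omega>) * score1 d p (x \<omega>) j)) \<and>
    integrable M (\<lambda>\<omega>. norm2 d (gradient d p \<phi> (x \<omega>)))"

subsection \<open>The single index volatility model\<close>

text \<open>The library's \<open>indep_var\<close> needs two random variables of the same type.\<close>

definition independent_rvs ::
  "'w measure \<Rightarrow> 'a measure \<Rightarrow> ('w \<Rightarrow> 'a) \<Rightarrow> 'b measure \<Rightarrow> ('w \<Rightarrow> 'b) \<Rightarrow> bool"
  where "independent_rvs M S X T Y \<longleftrightarrow> X \<in> measurable M S \<and> Y \<in> measurable M T \<and>
    prob_space.indep_set M {X -` A \<inter> space M |A. A \<in> sets S} {Y -` B \<inter> space M |B. B \<in> sets T}"

text \<open>
  The derivatives \<open>f'\<close> and \<open>g'\<close> are required only at the values that the indices take on the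
  support of \<open>x\<close>, relative to these values.
\<close>

locale single_index_volatility = prob_space M
  for M :: "'w measure" +
  fixes d :: nat
    and p :: "(nat \<Rightarrow> real) \<Rightarrow> real"
    and x :: "'w \<Rightarrow> nat \<Rightarrow> real"
    and \<epsilon> y :: "'w \<Rightarrow> real"
    and f f' g g' :: "real \<Rightarrow> real"
    and \<beta> \<gamma> :: "nat \<Rightarrow> real"
  assumes density_nonneg: "\<And>u. p u \<ge> 0"
    and x_density: "distributed M (Rd_lebesgue d) x (\<lambda>u. ennreal (p u))"
    and x_\<epsilon>_indep: "independent_rvs M (Rd_borel d) x borel \<epsilon>"
    and \<epsilon>_integrable: "integrable M \<epsilon>"
    and \<epsilon>_mean: "expectation \<epsilon> = 0"
    and \<epsilon>_square_integrable: "integrable M (\<lambda>\<omega>. (\<epsilon> \<omega>)\<^sup>2)"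
    and \<epsilon>_second_moment: "expectation (\<lambda>\<omega>. (\<epsilon> \<omega>)\<^sup>2) = 1"
    and \<beta>_unit: "norm2 d \<beta> = 1"
    and \<gamma>_unit: "norm2 d \<gamma> = 1"
    and f_borel: "f \<in> borel_measurable borel" and f'_borel: "f' \<in> borel_measurable borel"
    and g_borel: "g \<in> borel_measurable borel" and g'_borel: "g' \<in> borel_measurable borel"
    and f_deriv: "\<And>t. t \<in> (\<lambda>u. dot d u \<beta>) ` density_support d p \<Longrightarrow>
      (f has_real_derivative f' t) (at t within (\<lambda>u. dot d u \<beta>) ` density_support d p)"
    and g_deriv: "\<And>t. t \<in> (\<lambda>u. dot d u \<gamma>) ` density_support d p \<Longrightarrow>
      (g has_real_derivative g' t) (at t within (\<lambda>u. dot d u \<gamma>) ` density_support d p)"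
    and y_model: "\<And>\<omega>. \<omega> \<in> space M \<Longrightarrow> y \<omega> = f (dot d (x \<omega>) \<beta>) + g (dot d (x \<omega>) \<gamma>) * \<epsilon> \<omega>"

text \<open>The constants $\eta_1 = E[f f']$ and $\mu_1 = E[g g']$ at the index with direction \<open>v\<close>.\<close>

definition mean_fun_deriv ::
  "'w measure \<Rightarrow> nat \<Rightarrow> ('w \<Rightarrow> nat \<Rightarrow> real) \<Rightarrow> (real \<Rightarrow> real) \<Rightarrow> (real \<Rightarrow> real) \<Rightarrow> (nat \<Rightarrow> real) \<Rightarrow> real"
  where "mean_fun_deriv M d x h h' v = (\<integral>\<omega>. h (dot d (x \<omega>) v) * h' (dot d (x \<omega>) v) \<partial>M)"

definition iid_copies ::
  "'w measure \<Rightarrow> nat \<Rightarrow> nat \<Rightarrow> ('w \<Rightarrow> nat \<Rightarrow> real) \<Rightarrow> ('w \<Rightarrow> real)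
    \<Rightarrow> (nat \<Rightarrow> 'w \<Rightarrow> nat \<Rightarrow> real) \<Rightarrow> (nat \<Rightarrow> 'w \<Rightarrow> real) \<Rightarrow> bool"
  where "iid_copies M d n x y xs ys \<longleftrightarrow>
    prob_space.indep_vars M (\<lambda>_. Rd_borel d \<Otimes>\<^sub>M borel) (\<lambda>i \<omega>. (xs i \<omega>, ys i \<omega>)) {..<n} \<and>
    (\<forall>i<n. distr M (Rd_borel d \<Otimes>\<^sub>M borel) (\<lambda>\<omega>. (xs i \<omega>, ys i \<omega>)) =
           distr M (Rd_borel d \<Otimes>\<^sub>M borel) (\<lambda>\<omega>. (x \<omega>, y \<omega>)))"

subsection \<open>The finite moment assumption\<close>

definition moment_le :: "'w measure \<Rightarrow> real \<Rightarrow> ('w \<Rightarrow> real) \<Rightarrow> real \<Rightarrow> bool"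
  where "moment_le M q Z B \<longleftrightarrow>
    integrable M (\<lambda>\<omega>. \<bar>Z \<omega>\<bar> powr q) \<and> (\<integral>\<omega>. \<bar>Z \<omega>\<bar> powr q \<partial>M) \<le> B"

text \<open>
  \<open>c\<close> is the constant implicit in $E|y|^q \lesssim B$.  The existence of the Hessian of \<open>p\<close> is
  implicit in the bound on the second-order score.  A constant that enters a tuning parameter, such
  as $M_6$ in $\tau$ and $\kappa$ (with the numerical factor 14), has to bound the moment of \<open>y\<close>
  as well: this is the case \<open>c = 1\<close>, which is reached by enlarging \<open>B\<close>.
\<close>

definition finite_moment_assumption ::
  "'w measure \<Rightarrow> nat \<Rightarrow> ((nat \<Rightarrow> real) \<Rightarrow> real) \<Rightarrow> ('w \<Rightarrow> nat \<Rightarrow> real) \<Rightarrow> ('w \<Rightarrow> real) \<Rightarrow> ('w \<Rightarrow> real)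
    \<Rightarrow> (real \<Rightarrow> real) \<Rightarrow> (real \<Rightarrow> real) \<Rightarrow> (nat \<Rightarrow> real) \<Rightarrow> (nat \<Rightarrow> real)
    \<Rightarrow> real \<Rightarrow> real \<Rightarrow> real \<Rightarrow> bool"
  where "finite_moment_assumption M d p x \<epsilon> y f g \<beta> \<gamma> q B c \<longleftrightarrow>
    B > 0 \<and>
    integrable M (\<lambda>\<omega>. \<bar>\<epsilon> \<omega>\<bar> powr q) \<and>
    (\<forall>v. norm2 d v = 1 \<longrightarrow> moment_le M q (\<lambda>\<omega>. dot d (x \<omega>) v) B) \<and>
    moment_le M q (\<lambda>\<omega>. f (dot d (x \<omega>) \<beta>)) B \<and>
    moment_le M q (\<lambda>\<omega>. g (dot d (x \<omega>) \<gamma>)) B \<and>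
    (\<forall>j<d. moment_le M q (\<lambda>\<omega>. score1 d p (x \<omega>) j) B) \<and>
    (\<forall>u\<in>support_interior d p. \<forall>j<d. \<exists>G. has_gradient d (\<lambda>v. gradient d p p v j) G u UNIV) \<and>
    (\<forall>j<d. \<forall>k<d. moment_le M q (\<lambda>\<omega>. score2 d p (x \<omega>) j k) B) \<and>
    moment_le M q y (c * B)"

subsection \<open>Estimators\<close>

definition truncate :: "real \<Rightarrow> real \<Rightarrow> real"
  where "truncate \<tau> v = (if \<bar>v\<bar> \<le> \<tau> then v else 0)"

definition soft_threshold :: "real \<Rightarrow> real \<Rightarrow> real"
  where "soft_threshold l v = max 0 (1 - l / \<bar>v\<bar>) * v"

definition w_bar ::
  "nat \<Rightarrow> nat \<Rightarrow> ((nat \<Rightarrow> real) \<Rightarrow> real) \<Rightarrow> real \<Rightarrow> (nat \<Rightarrow> nat \<Rightarrow> real) \<Rightarrow> (nat \<Rightarrow> real) \<Rightarrow> nat \<Rightarrow> real"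
  where "w_bar d n p \<tau> X Y j =
    (1 / real n) * (\<Sum>i<n. (truncate \<tau> (Y i))\<^sup>2 * truncate \<tau> (score1 d p (X i) j))"

definition w_hat ::
  "nat \<Rightarrow> nat \<Rightarrow> ((nat \<Rightarrow> real) \<Rightarrow> real) \<Rightarrow> real \<Rightarrow> real \<Rightarrow> (nat \<Rightarrow> nat \<Rightarrow> real) \<Rightarrow> (nat \<Rightarrow> real)
    \<Rightarrow> nat \<Rightarrow> real"
  where "w_hat d n p \<tau> \<kappa> X Y j = soft_threshold \<kappa> (w_bar d n p \<tau> X Y j)"

definition gamma_hat5 ::
  "nat \<Rightarrow> nat \<Rightarrow> ((nat \<Rightarrow> real) \<Rightarrow> real) \<Rightarrow> real \<Rightarrow> real \<Rightarrow> real \<Rightarrow> (nat \<Rightarrow> real)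
    \<Rightarrow> (nat \<Rightarrow> nat \<Rightarrow> real) \<Rightarrow> (nat \<Rightarrow> real) \<Rightarrow> nat \<Rightarrow> real"
  where "gamma_hat5 d n p \<tau> \<kappa> l b X Y j =
    soft_threshold l (w_bar d n p \<tau> X Y j - dot d b (w_hat d n p \<tau> \<kappa> X Y) * b j)"

subsection \<open>The preliminary estimator\<close>

text \<open>\<open>K\<close> is the constant implicit in the three bounds.\<close>

definition preliminary_estimator ::
  "'w measure \<Rightarrow> nat \<Rightarrow> nat \<Rightarrow> nat \<Rightarrow> real \<Rightarrow> (nat \<Rightarrow> real) \<Rightarrow> ('w \<Rightarrow> nat \<Rightarrow> real) \<Rightarrow> bool"
  where "preliminary_estimator M d n s K \<beta> b \<longleftrightarrow> (\<forall>\<delta>. 0 < \<delta> \<and> \<delta> < 1 \<longrightarrow>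
    measure M {\<omega> \<in> space M.
      norm2 d (\<lambda>j. b \<omega> j - \<beta> j) \<le> K * sqrt (real s * ln (real d / \<delta>) / real n) \<and>
      norm1 d (\<lambda>j. b \<omega> j - \<beta> j) \<le> K * (real s * sqrt (ln (real d / \<delta>) / real n)) \<and>
      norm_inf d (\<lambda>j. b \<omega> j - \<beta> j) \<le> K * sqrt (ln (real d / \<delta>) / real n)} \<ge> 1 - \<delta>)"

end

theory Submission
  imports Defs
begin

text \<open>
  Stein's identity gives $E[y^2 S(x)] = w := 2\eta_1\beta + 2\mu_1\gamma$.  A Bernstein bound for the
  truncated mean, whose bias is of the order $M_6/\tau^3$, shows that $\bar w$ is entrywise within
  $8\sqrt{M_6 L/n}$ of \<open>w\<close>, where $L = \log(2d/\delta)$.  Since \<open>\<beta>\<close> and \<open>\<gamma>\<close> are orthogonal,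
  $\langle\beta, w\rangle = 2\eta_1$, so subtracting the projection on the estimated direction leaves
  $2\mu_1\gamma$ up to an entrywise error of order \<open>\<kappa>\<close>, and soft thresholding turns an entrywise error
  into the $\ell_2$ and $\ell_1$ bounds on the support of \<open>\<gamma>\<close>.  The error of the
  estimated direction is of order \<open>\<kappa>\<close> because $\mu_1 \ne 0$ forces
  $\sqrt{M_6} \ge |\mu_1| / \|\gamma\|_1$.

  Stein's identity is integration by parts on almost every line parallel to an axis.  The density
  vanishes at the boundary of its support but is not smooth there, so it is first composed with a
  \<open>C\<^sup>1\<close> cut-off that vanishes near 0.
\<close>

section \<open>Thresholding and projection\<close>

text \<open>Put \<open>m = sqrt M6\<close> and \<open>r = sqrt (L / n)\<close>. The truncation level
  satisfies \<open>\<tau> ^ 3 = m / r\<close>; this value balances the bias, then at most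
  \<open>2 m r\<close>, with the range of the summands, which permits an exponential moment at
  \<open>h = r / m\<close>. The deviation \<open>8 m r\<close> consists of 2 parts bias and 6 parts
  fluctuation, and \<open>\<kappa> = 14 m r\<close> adds 6 more, so that for
  \<open>r \<ge> 1/3\<close> it also covers the entries of \<open>w\<close>, which are at most
  \<open>2 m\<close>. What shapes the argument is that the final constant may contain none of
  \<open>n\<close>, \<open>d\<close>, \<open>s\<close> and \<open>M6\<close>, while \<open>r\<close>
  is not assumed small. The direction is known up to \<open>K r\<close> in each entry, and a product
  of two such errors would be quadratic in \<open>r\<close>. For small \<open>r\<close> one factor
  is absorbed; for large \<open>r\<close> the thresholded vector, and with it the product, is 0.
  Comparing \<open>r\<close> with \<open>m r\<close> then needs a lower bound on \<open>m\<close>.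
  The level \<open>\<delta>\<close> is halved between the two estimates, and since
  \<open>d / (\<delta> / 2) = 2 d / \<delta>\<close>, the logarithm of the preliminary estimator
  becomes \<open>L\<close>: both errors are governed by the same \<open>r\<close>.\<close>

lemma abs_soft_threshold:
  assumes "0 \<le> l"
  shows "\<bar>soft_threshold l v\<bar> = max 0 (\<bar>v\<bar> - l)"
proof (cases "v = 0")
  case False
  have "\<bar>soft_threshold l v\<bar> = max 0 (1 - l / \<bar>v\<bar>) * \<bar>v\<bar>"
    by (simp add: soft_threshold_def abs_mult)
  also have "\<dots> = max 0 (\<bar>v\<bar> - l)"
    using False by (auto simp: max_def field_simps)
  finally show ?thesis .
qed (use assms in \<open>simp add: soft_threshold_def\<close>)

lemma soft_threshold_eq_0:
  assumes "0 \<le> l" "\<bar>v\<bar> \<le> l"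
  shows "soft_threshold l v = 0"
  using abs_soft_threshold[OF assms(1), of v] assms(2) by simp

lemma soft_threshold_diff:
  assumes "0 \<le> l"
  shows "\<bar>soft_threshold l v - v\<bar> \<le> l"
proof (cases "\<bar>v\<bar> \<le> l")
  case True
  then show ?thesis using assms by (simp add: soft_threshold_eq_0)
next
  case False
  then have "v \<noteq> 0" "1 - l / \<bar>v\<bar> \<ge> 0" using assms by (auto simp: field_simps)
  then have "soft_threshold l v - v = - (l / \<bar>v\<bar> * v)"
    by (simp add: soft_threshold_def algebra_simps)
  moreover have "\<bar>l / \<bar>v\<bar> * v\<bar> = l" using \<open>v \<noteq> 0\<close> assms by (simp add: abs_mult)
  ultimately show ?thesis by simp
qed

text \<open>A threshold that dominates the noise removes at least what the noise can have added.
  Summed over the entries, this bounds the l1 norm of the thresholded vector by that of the true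
  one, without a count of nonzero entries.\<close>

lemma abs_soft_threshold_le:
  assumes "\<bar>v - w\<bar> \<le> l"
  shows "\<bar>soft_threshold l v\<bar> \<le> \<bar>w\<bar>"
  using assms by (subst abs_soft_threshold) auto

text \<open>Where \<open>w\<close> vanishes, \<open>v\<close> is pure noise of size at most
  \<open>l\<close> and is set to exactly 0. Only the at most \<open>s\<close> entries of the support
  contribute, each with \<open>l\<close> for the noise and \<open>l\<close> for the
  shrinkage.\<close>

lemma soft_threshold_sparse:
  assumes l: "0 \<le> l" and close: "\<And>j. j < d \<Longrightarrow> \<bar>v j - w j\<bar> \<le> l" and s: "norm0 d w \<le> s"
  shows "norm2 d (\<lambda>j. soft_threshold l (v j) - w j) \<le> 2 * sqrt (real s) * l"
    and "norm1 d (\<lambda>j. soft_threshold l (v j) - w j) \<le> 2 * real s * l"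
proof -
  define A where "A = {j. j < d \<and> w j \<noteq> 0}"
  define e where "e = (\<lambda>j. soft_threshold l (v j) - w j)"
  have A: "A \<subseteq> {..<d}" "card A \<le> s" using s by (auto simp: A_def norm0_def)
  have off: "e j = 0" if "j \<in> {..<d} - A" for j
  proof -
    have "w j = 0" "j < d" using that by (auto simp: A_def)
    then show ?thesis using close[of j] l by (simp add: e_def soft_threshold_eq_0)
  qed
  have on: "\<bar>e j\<bar> \<le> 2 * l" if "j \<in> A" for j
  proof -
    have "\<bar>v j - w j\<bar> \<le> l" using that close by (simp add: A_def)
    then show ?thesis using soft_threshold_diff[OF l, of "v j"] unfolding e_def by linarith
  qed
  have "(\<Sum>j<d. \<bar>e j\<bar>) = (\<Sum>j\<in>A. \<bar>e j\<bar>)"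
    using A off by (intro sum.mono_neutral_right) auto
  also have "\<dots> \<le> real (card A) * (2 * l)" using on by (intro sum_bounded_above) auto
  also have "\<dots> \<le> real s * (2 * l)" using A l by (intro mult_right_mono) auto
  finally show "norm1 d (\<lambda>j. soft_threshold l (v j) - w j) \<le> 2 * real s * l"
    by (simp add: norm1_def e_def mult_ac)
  have "(\<Sum>j<d. (e j)\<^sup>2) = (\<Sum>j\<in>A. (e j)\<^sup>2)"
    using A off by (intro sum.mono_neutral_right) auto
  also have "\<dots> \<le> real (card A) * (2 * l)\<^sup>2"
  proof (intro sum_bounded_above)
    fix j assume "j \<in> A"
    then have "\<bar>e j\<bar>\<^sup>2 \<le> (2 * l)\<^sup>2" by (intro power_mono on) auto
    then show "(e j)\<^sup>2 \<le> (2 * l)\<^sup>2" by simp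
  qed
  also have "\<dots> \<le> real s * (2 * l)\<^sup>2" using A by (intro mult_right_mono) auto
  finally have "L2_set e {..<d} \<le> sqrt (real s * (2 * l)\<^sup>2)"
    by (simp add: L2_set_def)
  also have "\<dots> = 2 * sqrt (real s) * l" using l by (simp add: real_sqrt_mult)
  finally show "norm2 d (\<lambda>j. soft_threshold l (v j) - w j) \<le> 2 * sqrt (real s) * l"
    by (simp add: norm2_def e_def)
qed

section \<open>Projecting out an estimated direction\<close>

lemma abs_dot_le:
  assumes "\<And>j. j < d \<Longrightarrow> \<bar>u j\<bar> \<le> B"
  shows "\<bar>dot d u v\<bar> \<le> B * norm1 d v"
proof -
  have "\<bar>dot d u v\<bar> \<le> (\<Sum>j<d. \<bar>u j\<bar> * \<bar>v j\<bar>)"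
    unfolding dot_def by (rule order_trans[OF sum_abs]) (simp add: abs_mult)
  also have "\<dots> \<le> (\<Sum>j<d. B * \<bar>v j\<bar>)"
    using assms by (intro sum_mono mult_right_mono) auto
  finally show ?thesis by (simp add: norm1_def sum_distrib_left)
qed

lemma dot_self: "dot d v v = (norm2 d v)\<^sup>2"
  by (simp add: dot_def norm2_def L2_set_def sum_nonneg flip: power2_eq_square)

lemma unit_abs_le_1:
  assumes "norm2 d v = 1" "j < d"
  shows "\<bar>v j\<bar> \<le> 1"
proof -
  have "\<bar>v j\<bar> \<le> L2_set (\<lambda>j. \<bar>v j\<bar>) {..<d}" using assms by (intro member_le_L2_set) auto
  also have "\<dots> = norm2 d v" by (simp add: norm2_def L2_set_def)
  finally show ?thesis using assms by simp
qed

lemma unit_dim_pos: "norm2 d v = 1 \<Longrightarrow> 0 < d"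
  by (cases d) (auto simp: norm2_def)

lemma abs_le_norm_inf: "j < d \<Longrightarrow> \<bar>v j\<bar> \<le> norm_inf d v"
  unfolding norm_inf_def by (intro Max_ge) auto

text \<open>
  For \<open>r \<ge> 1/3\<close> the noise level \<open>\<kappa>\<close> exceeds every entry of \<open>W\<close>, so that the thresholded vector
  vanishes; this is what keeps the product of the two estimation errors of order \<open>\<kappa>\<close>.
\<close>

lemma projected_deviation_le:
  fixes m r \<kappa> K \<eta> \<mu> :: real
  assumes m: "0 < m" and r: "0 \<le> r" and \<kappa>: "\<kappa> = 14 * m * r" and K: "0 < K"
    and \<beta>: "norm2 d \<beta> = 1" and \<gamma>: "norm2 d \<gamma> = 1" and orth: "dot d \<beta> \<gamma> = 0"
    and \<mu>: "\<mu> \<noteq> 0"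
    and w: "\<And>j. j < d \<Longrightarrow> \<bar>2 * \<eta> * \<beta> j + 2 * \<mu> * \<gamma> j\<bar> \<le> 2 * m"
    and \<mu>m: "\<And>j. j < d \<Longrightarrow> \<bar>2 * \<mu> * \<gamma> j\<bar> \<le> 2 * m"
    and W: "\<And>j. j < d \<Longrightarrow> \<bar>W j - (2 * \<eta> * \<beta> j + 2 * \<mu> * \<gamma> j)\<bar> \<le> 8 * m * r"
    and b: "\<And>j. j < d \<Longrightarrow> \<bar>b j - \<beta> j\<bar> \<le> K * r"
    and N: "N = 2 * \<bar>\<eta>\<bar> * norm1 d \<beta> + 2 * \<bar>\<mu>\<bar> * norm1 d \<gamma>"
    and j: "j < d"
  shows "\<bar>W j - dot d b (\<lambda>j. soft_threshold \<kappa> (W j)) * b j - 2 * \<mu> * \<gamma> j\<bar>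
    \<le> (1 + 2 * norm1 d \<beta> + K * N * (2 + K) * norm1 d \<gamma> / \<bar>\<mu>\<bar>) * \<kappa>"
proof -
  define w where "w = (\<lambda>j. 2 * \<eta> * \<beta> j + 2 * \<mu> * \<gamma> j)"
  define h where "h = (\<lambda>j. soft_threshold \<kappa> (W j))"
  define a where "a = dot d b h"
  have \<kappa>0: "0 \<le> \<kappa>" using m r \<kappa> by simp
  have Ww: "\<bar>W j - w j\<bar> \<le> \<kappa>" if "j < d" for j
  proof -
    have "8 * m * r \<le> \<kappa>" using m r \<kappa> by simp
    then show ?thesis using W[OF that] by (simp add: w_def)
  qed
  have hw: "\<bar>h j - w j\<bar> \<le> 2 * \<kappa>" if "j < d" for j
    using Ww[OF that] soft_threshold_diff[OF \<kappa>0, of "W j"] unfolding h_def by linarith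
  have N0: "0 \<le> N" by (simp add: N norm1_def sum_nonneg)
  have w1: "norm1 d w \<le> N"
  proof -
    have "norm1 d w \<le> (\<Sum>j<d. 2 * \<bar>\<eta>\<bar> * \<bar>\<beta> j\<bar> + 2 * \<bar>\<mu>\<bar> * \<bar>\<gamma> j\<bar>)"
      unfolding norm1_def w_def
      by (intro sum_mono order_trans[OF abs_triangle_ineq]) (simp add: abs_mult)
    then show ?thesis by (simp add: N norm1_def sum.distrib sum_distrib_left)
  qed
  have h1: "norm1 d h \<le> N"
    using Ww by (intro order_trans[OF _ w1]) (auto simp: norm1_def h_def intro!: sum_mono abs_soft_threshold_le)
  \<comment> \<open>Pairing \<open>2 \<mu> \<gamma>\<close> with the unit vector
    \<open>\<gamma>\<close> gives \<open>2 \<mu>\<close>; the sup-norm bound \<open>2 m\<close>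
    turns this into a lower bound on \<open>m\<close>.\<close>
  have \<beta>1: "0 \<le> norm1 d \<beta>" and \<gamma>1: "0 < norm1 d \<gamma>" and m\<mu>: "\<bar>\<mu>\<bar> \<le> m * norm1 d \<gamma>"
  proof -
    show "0 \<le> norm1 d \<beta>" by (simp add: norm1_def sum_nonneg)
    have "\<bar>dot d (\<lambda>j. 2 * \<mu> * \<gamma> j) \<gamma>\<bar> \<le> 2 * m * norm1 d \<gamma>"
      by (intro abs_dot_le \<mu>m)
    moreover have "dot d (\<lambda>j. 2 * \<mu> * \<gamma> j) \<gamma> = 2 * \<mu> * dot d \<gamma> \<gamma>"
      by (simp add: dot_def sum_distrib_left mult_ac)
    ultimately show "\<bar>\<mu>\<bar> \<le> m * norm1 d \<gamma>" using \<gamma> by (simp add: dot_self abs_mult)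
    then show "0 < norm1 d \<gamma>" using \<mu> m by (smt (verit) mult_nonneg_nonpos2 zero_less_abs_iff mult.commute)
  qed
  \<comment> \<open>The error of \<open>b\<close> is a multiple of \<open>r\<close>, but the claim
    is in units of \<open>\<kappa> = 14 m r\<close>. The lower bound on \<open>m\<close> converts
    the one into the other by a factor that does not contain \<open>m\<close>.\<close>
  have r\<kappa>: "14 * r \<le> norm1 d \<gamma> / \<bar>\<mu>\<bar> * \<kappa>"
  proof -
    have "\<bar>\<mu>\<bar> * r \<le> m * norm1 d \<gamma> * r" using m\<mu> r by (intro mult_right_mono) auto
    then show ?thesis using \<mu> by (simp add: \<kappa> field_simps)
  qed
  have dw: "dot d \<beta> w = 2 * \<eta>"
  proof -
    have "dot d \<beta> w = 2 * \<eta> * dot d \<beta> \<beta> + 2 * \<mu> * dot d \<beta> \<gamma>"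
      by (simp add: dot_def w_def sum_distrib_left sum.distrib algebra_simps)
    then show ?thesis using \<beta> orth by (simp add: dot_self)
  qed
  have a\<eta>: "\<bar>a - 2 * \<eta>\<bar> \<le> K * r * N + 2 * \<kappa> * norm1 d \<beta>"
  proof -
    \<comment> \<open>Each term pairs a vector that is small in sup norm with one whose l1 norm
      enters the constant.\<close>
    have "a - 2 * \<eta> = dot d (\<lambda>j. b j - \<beta> j) h + dot d (\<lambda>j. h j - w j) \<beta>"
      unfolding a_def dw[symmetric] by (simp add: dot_def algebra_simps sum_subtractf sum.distrib)
    moreover have "\<bar>dot d (\<lambda>j. b j - \<beta> j) h\<bar> \<le> K * r * norm1 d h" by (intro abs_dot_le b)
    moreover have "K * r * norm1 d h \<le> K * r * N" using K r h1 by (intro mult_left_mono) auto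
    moreover have "\<bar>dot d (\<lambda>j. h j - w j) \<beta>\<bar> \<le> 2 * \<kappa> * norm1 d \<beta>" by (intro abs_dot_le hw)
    ultimately show ?thesis by linarith
  qed
  have aN: "\<bar>a\<bar> \<le> (1 + K) * N"
  proof (cases "r \<le> 1 / 3")
    case True
    have "\<bar>b j\<bar> \<le> 1 + K" if "j < d" for j
    proof -
      have "K * r \<le> K * 1" using True K by (intro mult_left_mono) auto
      then show ?thesis using b[OF that] unit_abs_le_1[OF \<beta> that] by linarith
    qed
    then have "\<bar>a\<bar> \<le> (1 + K) * norm1 d h" unfolding a_def by (intro abs_dot_le)
    also have "\<dots> \<le> (1 + K) * N" using K h1 by (intro mult_left_mono) auto
    finally show ?thesis .
  next
    case False
    \<comment> \<open>Here \<open>8 m r\<close> of noise and \<open>2 m\<close> of signal together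
      stay below \<open>14 m r\<close>.\<close>
    have "h j = 0" if "j < d" for j
    proof -
      have "m * (1 / 3) \<le> m * r" using False m by (intro mult_left_mono) auto
      then have "\<bar>W j\<bar> \<le> \<kappa>" using W[OF that] w[OF that] unfolding \<kappa> by linarith
      then show ?thesis using \<kappa>0 by (simp add: h_def soft_threshold_eq_0)
    qed
    then have "a = 0" by (simp add: a_def dot_def)
    then show ?thesis using K N0 by simp
  qed
  \<comment> \<open>Noise, error of the direction, error of the coefficient. Inserting the bound
    \<open>a\<eta>\<close> for the coefficient into the middle term would produce terms quadratic in
    \<open>r\<close>; the bound \<open>aN\<close>, uniform in \<open>r\<close>, avoids them.\<close>
  have "W j - a * b j - 2 * \<mu> * \<gamma> j = (W j - w j) - a * (b j - \<beta> j) - (a - 2 * \<eta>) * \<beta> j"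
    by (simp add: w_def algebra_simps)
  then have "\<bar>W j - a * b j - 2 * \<mu> * \<gamma> j\<bar> \<le> \<bar>W j - w j\<bar> + \<bar>a\<bar> * \<bar>b j - \<beta> j\<bar> + \<bar>a - 2 * \<eta>\<bar> * \<bar>\<beta> j\<bar>"
    by (simp add: abs_mult[symmetric])
  also have "\<dots> \<le> \<kappa> + (1 + K) * N * (K * r) + (K * r * N + 2 * \<kappa> * norm1 d \<beta>) * 1"
    using K N0 a\<eta> aN b[OF j] unit_abs_le_1[OF \<beta> j] Ww[OF j]
    by (intro add_mono mult_mono) auto
  also have "\<dots> = \<kappa> + 2 * norm1 d \<beta> * \<kappa> + K * N * (2 + K) * r" by (simp add: algebra_simps)
  also have "\<dots> \<le> \<kappa> + 2 * norm1 d \<beta> * \<kappa> + K * N * (2 + K) * (norm1 d \<gamma> / \<bar>\<mu>\<bar> * \<kappa>)"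
  proof -
    have "r \<le> norm1 d \<gamma> / \<bar>\<mu>\<bar> * \<kappa>" using r\<kappa> r by simp
    then show ?thesis using K N0 by (intro add_left_mono mult_left_mono) auto
  qed
  also have "\<dots> = (1 + 2 * norm1 d \<beta> + K * N * (2 + K) * norm1 d \<gamma> / \<bar>\<mu>\<bar>) * \<kappa>"
    by (simp add: algebra_simps add_divide_distrib)
  finally show ?thesis unfolding a_def h_def .
qed

section \<open>Bernstein inequality for bounded variables\<close>

text \<open>For negative \<open>z\<close>, multiply by \<open>1 - z \<le> exp (- z)\<close>: the
  left side becomes at most 1, while \<open>(1 + z + z\<^sup>2) (1 - z) = 1 - z ^ 3\<close> is at
  least 1.\<close>

lemma exp_le_quadratic:
  fixes z :: real
  assumes "\<bar>z\<bar> \<le> 1"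
  shows "exp z \<le> 1 + z + z\<^sup>2"
proof (cases "z \<ge> 0")
  case True
  then show ?thesis using assms exp_bound by simp
next
  case False
  have "exp z * (1 - z) \<le> exp z * exp (- z)"
    using exp_ge_add_one_self[of "- z"] by (intro mult_left_mono) auto
  also have "\<dots> = 1" by (simp add: exp_minus)
  also have "1 \<le> (1 + z + z\<^sup>2) * (1 - z)"
  proof -
    have "(1 + z + z\<^sup>2) * (1 - z) = 1 - z * z\<^sup>2" by (simp add: power2_eq_square algebra_simps)
    moreover have "z * z\<^sup>2 \<le> 0" using False by (intro mult_nonpos_nonneg) auto
    ultimately show ?thesis by linarith
  qed
  finally show ?thesis using False by (simp add: mult_le_cancel_right)
qed

context prob_space
begin

text \<open>The quadratic bound is applied to the uncentred \<open>h Z\<close>, which lies in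
  [-1, 1]; centring afterwards only multiplies by a constant. So the raw second moment takes the
  place of the variance, and centring does not enlarge the range.\<close>

lemma bounded_mgf_le:
  fixes Z :: "'a \<Rightarrow> real"
  assumes [measurable]: "Z \<in> borel_measurable M"
    and bound: "\<And>\<omega>. \<omega> \<in> space M \<Longrightarrow> \<bar>h * Z \<omega>\<bar> \<le> 1"
    and h: "h \<noteq> 0"
    and second: "expectation (\<lambda>\<omega>. (Z \<omega>)\<^sup>2) \<le> V"
  shows "expectation (\<lambda>\<omega>. exp (h * (Z \<omega> - expectation Z))) \<le> exp (h\<^sup>2 * V)"
proof -
  have Zb: "\<bar>Z \<omega>\<bar> \<le> 1 / \<bar>h\<bar>" if "\<omega> \<in> space M" for \<omega>
    using bound[OF that] h by (simp add: abs_mult field_simps)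
  have Z[simp]: "integrable M Z"
    using Zb by (intro integrable_const_bound[where B = "1 / \<bar>h\<bar>"] AE_I2) auto
  have Z2[simp]: "integrable M (\<lambda>\<omega>. (Z \<omega>)\<^sup>2)"
  proof (intro integrable_const_bound[where B = "(1 / \<bar>h\<bar>)\<^sup>2"] AE_I2)
    fix \<omega> assume "\<omega> \<in> space M"
    from power_mono[OF Zb[OF this] abs_ge_zero, of 2]
    show "norm ((Z \<omega>)\<^sup>2) \<le> (1 / \<bar>h\<bar>)\<^sup>2" by simp
  qed simp
  have e[simp]: "integrable M (\<lambda>\<omega>. exp (h * Z \<omega>))"
  proof (intro integrable_const_bound[where B = "exp 1"] AE_I2)
    fix \<omega> assume "\<omega> \<in> space M"
    from bound[OF this] show "norm (exp (h * Z \<omega>)) \<le> exp 1" by simp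
  qed simp
  have "expectation (\<lambda>\<omega>. exp (h * Z \<omega>)) \<le> expectation (\<lambda>\<omega>. 1 + h * Z \<omega> + h\<^sup>2 * (Z \<omega>)\<^sup>2)"
    using exp_le_quadratic[OF bound] by (intro integral_mono) (auto simp: power_mult_distrib)
  also have "\<dots> = 1 + h * expectation Z + h\<^sup>2 * expectation (\<lambda>\<omega>. (Z \<omega>)\<^sup>2)"
    by (simp add: prob_space)
  also have "\<dots> \<le> 1 + (h * expectation Z + h\<^sup>2 * V)"
    using second by (simp add: mult_left_mono)
  also have "\<dots> \<le> exp (h * expectation Z + h\<^sup>2 * V)" by (rule exp_ge_add_one_self)
  finally have "expectation (\<lambda>\<omega>. exp (h * Z \<omega>)) * exp (- (h * expectation Z))
      \<le> exp (h * expectation Z + h\<^sup>2 * V) * exp (- (h * expectation Z))"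
    by (intro mult_right_mono) auto
  moreover have "expectation (\<lambda>\<omega>. exp (h * (Z \<omega> - expectation Z)))
      = expectation (\<lambda>\<omega>. exp (h * Z \<omega>) * exp (- (h * expectation Z)))"
    by (intro Bochner_Integration.integral_cong refl) (simp add: exp_add[symmetric] right_diff_distrib)
  moreover have "exp (h * expectation Z + h\<^sup>2 * V) * exp (- (h * expectation Z)) = exp (h\<^sup>2 * V)"
    by (simp add: exp_add[symmetric])
  ultimately show ?thesis by (simp only: integral_mult_left_zero)
qed

text \<open>The Chernoff argument at one fixed \<open>h\<close> instead of an optimised one: in the
  application \<open>h\<close> is the largest value that the bound on the truncated summands
  permits. The sign of \<open>h\<close> is free, so that \<open>- h\<close> yields the lower
  tail.\<close>

lemma bernstein_one_sided:
  fixes Z :: "nat \<Rightarrow> 'a \<Rightarrow> real"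
  assumes indep: "indep_vars (\<lambda>_. borel) Z {..<n}"
    and bound: "\<And>i \<omega>. i < n \<Longrightarrow> \<omega> \<in> space M \<Longrightarrow> \<bar>h * Z i \<omega>\<bar> \<le> 1"
    and h: "h \<noteq> 0"
    and second: "\<And>i. i < n \<Longrightarrow> expectation (\<lambda>\<omega>. (Z i \<omega>)\<^sup>2) \<le> V"
  shows "prob {\<omega> \<in> space M. c \<le> h * (\<Sum>i<n. Z i \<omega> - expectation (Z i))}
    \<le> exp (real n * (h\<^sup>2 * V) - c)"
proof -
  define E where "E = (\<lambda>i \<omega>. exp (h * (Z i \<omega> - expectation (Z i))))"
  have Z[measurable]: "Z i \<in> borel_measurable M" if "i < n" for i
    using indep that by (auto simp: indep_vars_def)
  have E_indep: "indep_vars (\<lambda>_. borel) E {..<n}"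
    unfolding E_def by (rule indep_vars_compose2[OF indep]) measurable
  have E_int: "integrable M (E i)" if "i < n" for i
  proof (intro integrable_const_bound[where B = "exp (1 + \<bar>h * expectation (Z i)\<bar>)"] AE_I2)
    fix \<omega> assume "\<omega> \<in> space M"
    with bound[OF that this] show "norm (E i \<omega>) \<le> exp (1 + \<bar>h * expectation (Z i)\<bar>)"
      by (simp add: E_def algebra_simps)
  qed (use that in \<open>simp add: E_def\<close>)
  have prod: "expectation (\<lambda>\<omega>. \<Prod>i<n. E i \<omega>) = (\<Prod>i<n. expectation (E i))"
    "integrable M (\<lambda>\<omega>. \<Prod>i<n. E i \<omega>)"
    using E_int by (auto intro!: indep_vars_lebesgue_integral indep_vars_integrable E_indep)
  have eq: "(\<Prod>i<n. E i \<omega>) = exp (h * (\<Sum>i<n. Z i \<omega> - expectation (Z i)))" for \<omega>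
    by (simp add: E_def exp_sum sum_distrib_left)
  have "prob {\<omega> \<in> space M. c \<le> h * (\<Sum>i<n. Z i \<omega> - expectation (Z i))}
      = prob {\<omega> \<in> space M. exp c \<le> (\<Prod>i<n. E i \<omega>)}"
    by (simp add: eq)
  also have "\<dots> \<le> expectation (\<lambda>\<omega>. \<Prod>i<n. E i \<omega>) / exp c"
    using prod(2) by (intro integral_Markov_inequality_measure[where A = "{}"])
      (auto simp: E_def intro!: prod_nonneg)
  also have "\<dots> \<le> exp (h\<^sup>2 * V) ^ n / exp c"
  proof -
    have "(\<Prod>i<n. expectation (E i)) \<le> (\<Prod>i<n. exp (h\<^sup>2 * V))"
    proof (intro prod_mono conjI)
      fix i assume "i \<in> {..<n}"
      then have "i < n" by simp
      show "0 \<le> expectation (E i)" by (simp add: E_def)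
      show "expectation (E i) \<le> exp (h\<^sup>2 * V)"
        unfolding E_def
        using bounded_mgf_le[where Z = "Z i" and h = h and V = V] bound h second Z \<open>i < n\<close>
        by blast
    qed
    then show ?thesis unfolding prod by (simp add: divide_right_mono)
  qed
  also have "\<dots> = exp (real n * (h\<^sup>2 * V) - c)"
    by (simp add: exp_diff exp_of_nat_mult)
  finally show ?thesis .
qed

lemma bernstein_two_sided:
  fixes Z :: "nat \<Rightarrow> 'a \<Rightarrow> real"
  assumes indep: "indep_vars (\<lambda>_. borel) Z {..<n}"
    and bound: "\<And>i \<omega>. i < n \<Longrightarrow> \<omega> \<in> space M \<Longrightarrow> \<bar>h * Z i \<omega>\<bar> \<le> 1"
    and h: "h \<noteq> 0"
    and second: "\<And>i. i < n \<Longrightarrow> expectation (\<lambda>\<omega>. (Z i \<omega>)\<^sup>2) \<le> V"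
  shows "prob {\<omega> \<in> space M. c \<le> \<bar>h * (\<Sum>i<n. Z i \<omega> - expectation (Z i))\<bar>}
    \<le> 2 * exp (real n * (h\<^sup>2 * V) - c)"
proof -
  have [measurable]: "Z i \<in> borel_measurable M" if "i < n" for i
    using indep that by (auto simp: indep_vars_def)
  let ?S = "\<lambda>\<omega>. \<Sum>i<n. Z i \<omega> - expectation (Z i)"
  have eq: "{\<omega> \<in> space M. c \<le> \<bar>h * ?S \<omega>\<bar>}
      = {\<omega> \<in> space M. c \<le> h * ?S \<omega>} \<union> {\<omega> \<in> space M. c \<le> (- h) * ?S \<omega>}"
    by auto
  have "prob {\<omega> \<in> space M. c \<le> \<bar>h * ?S \<omega>\<bar>}
      \<le> prob {\<omega> \<in> space M. c \<le> h * ?S \<omega>} + prob {\<omega> \<in> space M. c \<le> (- h) * ?S \<omega>}"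
    unfolding eq by (intro measure_Un_le) measurable
  also have "\<dots> \<le> exp (real n * (h\<^sup>2 * V) - c) + exp (real n * ((- h)\<^sup>2 * V) - c)"
  proof (rule add_mono)
    show "prob {\<omega> \<in> space M. c \<le> h * ?S \<omega>} \<le> exp (real n * (h\<^sup>2 * V) - c)"
      by (rule bernstein_one_sided[where Z = Z, OF indep]) (fact bound h second)+
    have "\<bar>- h * Z i \<omega>\<bar> \<le> 1" if "i < n" "\<omega> \<in> space M" for i \<omega>
      using bound[OF that] by simp
    moreover have "- h \<noteq> 0" using h by simp
    ultimately show "prob {\<omega> \<in> space M. c \<le> - h * ?S \<omega>} \<le> exp (real n * ((- h)\<^sup>2 * V) - c)"
      using bernstein_one_sided[where Z = Z and h = "- h" and V = V and c = c] indep second by blast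
  qed
  finally show ?thesis by simp
qed

end

section \<open>Lines and open sets in coordinate space\<close>

text \<open>By second countability of the line, an open set is a countable union of boxes with sides
  in a countable basis. This ties the topology, in which the interior of the support is defined, to
  the product sigma-algebra, in which it has to be measurable.\<close>

lemma openin_Rd_sets:
  assumes "openin (Rd_top d) U"
  shows "U \<in> sets (Rd_borel d)"
proof -
  obtain B :: "real set set" where B: "countable B" "topological_basis B"
    using ex_countable_basis by blast
  define \<F> where "\<F> = {V \<in> {..<d} \<rightarrow>\<^sub>E B. Pi\<^sub>E {..<d} V \<subseteq> U}"
  have "countable \<F>"
    unfolding \<F>_def using B(1)
    by (intro countable_subset[OF _ countable_PiE[of "{..<d}" "\<lambda>_. B"]]) auto
  moreover have "Pi\<^sub>E {..<d} V \<in> sets (Rd_borel d)" if "V \<in> \<F>" for V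
    using that topological_basis_open[OF B(2)]
    by (intro sets_PiM_I_finite) (auto simp: \<F>_def PiE_def Pi_def)
  ultimately have "(\<Union>V\<in>\<F>. Pi\<^sub>E {..<d} V) \<in> sets (Rd_borel d)" by (intro sets.countable_UN') auto
  also have "(\<Union>V\<in>\<F>. Pi\<^sub>E {..<d} V) = U"
  proof
    show "(\<Union>V\<in>\<F>. Pi\<^sub>E {..<d} V) \<subseteq> U" by (auto simp: \<F>_def)
    show "U \<subseteq> (\<Union>V\<in>\<F>. Pi\<^sub>E {..<d} V)"
    proof
      fix u assume "u \<in> U"
      then obtain W where W: "\<And>i. i < d \<Longrightarrow> open (W i)" "u \<in> Pi\<^sub>E {..<d} W" "Pi\<^sub>E {..<d} W \<subseteq> U"
        using bspec[OF assms[unfolded openin_product_topology_alt] \<open>u \<in> U\<close>] by auto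
      have "\<exists>V\<in>B. u i \<in> V \<and> V \<subseteq> W i" if "i < d" for i
        using topological_basisE[OF B(2) W(1)[OF that], of "u i"] W(2) that by (metis PiE_mem lessThan_iff)
      then obtain V where V: "\<And>i. i < d \<Longrightarrow> V i \<in> B \<and> u i \<in> V i \<and> V i \<subseteq> W i"
        by metis
      let ?V = "restrict V {..<d}"
      have "Pi\<^sub>E {..<d} ?V \<subseteq> Pi\<^sub>E {..<d} W" using V by (intro PiE_mono) auto
      then have "?V \<in> \<F>" using V W(3) by (auto simp: \<F>_def)
      moreover have "u \<in> Pi\<^sub>E {..<d} ?V" using V W(2) by (auto simp: PiE_iff)
      ultimately show "u \<in> (\<Union>V\<in>\<F>. Pi\<^sub>E {..<d} V)" by blast
    qed
  qed
  finally show ?thesis .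
qed

lemma sets_Rd_lebesgue: "sets (Rd_lebesgue d) = sets (Rd_borel d)"
  by (intro sets_PiM_cong) auto

lemma measurable_Rd_lebesgue: "measurable (Rd_lebesgue d) N = measurable (Rd_borel d) N"
  by (intro measurable_cong_sets sets_Rd_lebesgue refl)

lemma continuous_map_line:
  assumes "u \<in> topspace (Rd_top d)" "j < d"
  shows "continuous_map euclideanreal (Rd_top d) (\<lambda>t. u(j := t))"
  unfolding continuous_map_componentwise
  using assms by (auto simp: extensional_def PiE_def)

lemma openin_line:
  assumes "openin (Rd_top d) U" "u \<in> topspace (Rd_top d)" "j < d"
  shows "open {t. u(j := t) \<in> U}"
  using openin_continuous_map_preimage[OF continuous_map_line[OF assms(2,3)] assms(1)] by simp

text \<open>The line is continuous, and moving coordinate \<open>j\<close> leaves the point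
  \<open>u\<close>, so punctured neighbourhoods are respected. Through this lemma both the gradient
  and the boundary condition become statements about one variable.\<close>

lemma filterlim_line:
  assumes u: "u \<in> topspace (Rd_top d)" and j: "j < d"
  shows "filterlim (\<lambda>t. u(j := t)) (atin_within (Rd_top d) u X) (at (u j) within {t. u(j := t) \<in> X})"
  unfolding filterlim_iff
proof (intro allI impI)
  fix P assume "eventually P (atin_within (Rd_top d) u X)"
  then obtain T where T: "openin (Rd_top d) T" "u \<in> T" "\<And>v. v \<in> T \<Longrightarrow> v \<in> X \<Longrightarrow> v \<noteq> u \<Longrightarrow> P v"
    using u unfolding eventually_atin_within by blast
  show "\<forall>\<^sub>F t in at (u j) within {t. u(j := t) \<in> X}. P (u(j := t))"
    unfolding eventually_at_topological
  proof (intro exI[of _ "{t. u(j := t) \<in> T}"] conjI ballI impI)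
    fix t assume "t \<in> {t. u(j := t) \<in> T}" "t \<noteq> u j" "t \<in> {t. u(j := t) \<in> X}"
    then show "P (u(j := t))" by (intro T(3)) (auto dest: fun_cong[where x = j])
  qed (use openin_line[OF T(1) u j] T(2) in auto)
qed

text \<open>For a displacement along an axis the Frechet quotient is the one-dimensional one, except
  that it is divided by \<open>|t - u j|\<close> instead of \<open>t - u j\<close>; passing to
  absolute values removes the difference in sign.\<close>

lemma has_gradient_line:
  assumes grad: "has_gradient d \<phi> G u X" and u: "u \<in> topspace (Rd_top d)" and j: "j < d"
  shows "((\<lambda>t. \<phi> (u(j := t))) has_real_derivative G j) (at (u j) within {t. u(j := t) \<in> X})"
proof -
  let ?F = "at (u j) within {t. u(j := t) \<in> X}"
  have G: "dot d G (\<lambda>i. (u(j := t)) i - u i) = G j * (t - u j)" for t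
  proof -
    have "dot d G (\<lambda>i. (u(j := t)) i - u i) = (\<Sum>i<d. if i = j then G j * (t - u j) else 0)"
      unfolding dot_def by (intro sum.cong) auto
    then show ?thesis using j by simp
  qed
  have n: "norm2 d (\<lambda>i. (u(j := t)) i - u i) = \<bar>t - u j\<bar>" for t
  proof -
    have "(\<Sum>i<d. ((u(j := t)) i - u i)\<^sup>2) = (\<Sum>i<d. if i = j then (t - u j)\<^sup>2 else 0)"
      by (intro sum.cong) auto
    then show ?thesis using j by (simp add: norm2_def L2_set_def)
  qed
  have "((\<lambda>t. (\<phi> (u(j := t)) - \<phi> u - G j * (t - u j)) / \<bar>t - u j\<bar>) \<longlongrightarrow> 0) ?F"
    using filterlim_compose[OF grad[unfolded has_gradient_def] filterlim_line[OF u j]]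
    unfolding G n .
  then have "((\<lambda>t. \<bar>(\<phi> (u(j := t)) - \<phi> u - G j * (t - u j)) / \<bar>t - u j\<bar>\<bar>) \<longlongrightarrow> 0) ?F"
    by (rule tendsto_rabs_zero)
  moreover have "\<forall>\<^sub>F t in ?F. \<bar>(\<phi> (u(j := t)) - \<phi> u - G j * (t - u j)) / \<bar>t - u j\<bar>\<bar>
      = \<bar>(\<phi> (u(j := t)) - \<phi> u) / (t - u j) - G j\<bar>"
    unfolding eventually_at_filter
  proof (intro always_eventually allI impI)
    fix t assume "t \<noteq> u j"
    then have "(\<phi> (u(j := t)) - \<phi> u - G j * (t - u j)) / (t - u j) = (\<phi> (u(j := t)) - \<phi> u) / (t - u j) - G j"
      by (simp add: diff_divide_distrib)
    then show "\<bar>(\<phi> (u(j := t)) - \<phi> u - G j * (t - u j)) / \<bar>t - u j\<bar>\<bar>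
        = \<bar>(\<phi> (u(j := t)) - \<phi> u) / (t - u j) - G j\<bar>"
      by (metis abs_abs abs_divide)
  qed
  ultimately have "((\<lambda>t. \<bar>(\<phi> (u(j := t)) - \<phi> u) / (t - u j) - G j\<bar>) \<longlongrightarrow> 0) ?F"
    by (rule Lim_transform_eventually)
  then have "((\<lambda>t. (\<phi> (u(j := t)) - \<phi> u) / (t - u j)) \<longlongrightarrow> G j) ?F"
    by (simp add: tendsto_rabs_zero_iff LIM_zero_iff)
  then show ?thesis by (simp add: has_field_derivative_iff)
qed

section \<open>Integration by parts on an open subset of the line\<close>

text \<open>The gauge integral obeys the fundamental theorem for every derivative, and Lebesgue
  integrability transfers the value. This covers derivatives that are not continuous, as that of
  \<open>\<phi>\<close> along a line may be.\<close>

lemma set_lebesgue_integral_deriv: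
  fixes H H' :: "real \<Rightarrow> real"
  assumes deriv: "\<And>t. (H has_real_derivative H' t) (at t)"
    and H': "integrable lborel H'" and ab: "a \<le> b"
  shows "(\<integral>t. indicator {a..b} t *\<^sub>R H' t \<partial>lborel) = H b - H a"
proof -
  have "set_integrable lborel {a..b} H'"
    using H' unfolding set_integrable_def by (intro integrable_mult_indicator) auto
  moreover have "(H' has_integral (H b - H a)) {a..b}"
    using deriv ab
    by (intro fundamental_theorem_of_calculus)
      (auto simp: has_real_derivative_iff_has_vector_derivative[symmetric] intro: has_field_derivative_at_within)
  ultimately have "(LINT t:{a..b}|lborel. H' t) = H b - H a"
    by (simp add: set_borel_integral_eq_integral(2) integral_unique)
  then show ?thesis unfolding set_lebesgue_integral_def .
qed

text \<open>Integrability of \<open>H'\<close> gives a limit through the fundamental theorem, and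
  integrability of \<open>H\<close> forces it to be 0: for a nonzero limit \<open>L\<close>, a
  multiple of \<open>H\<close> would dominate the indicator of a half-line, which has infinite
  length.\<close>

lemma tendsto_0_at_top_if_integrable_deriv:
  fixes H H' :: "real \<Rightarrow> real"
  assumes deriv: "\<And>t. (H has_real_derivative H' t) (at t)"
    and H: "integrable lborel H" and H': "integrable lborel H'"
  shows "(H \<longlongrightarrow> 0) at_top"
proof -
  define I where "I = (\<lambda>y. \<integral>t. indicator {..y} t *\<^sub>R H' t \<partial>lborel)"
  have I: "(I \<longlongrightarrow> (\<integral>t. H' t \<partial>lborel)) at_top"
    unfolding I_def using H' by (intro tendsto_integral_at_top) auto
  have ftc: "H y - H 0 = I y - I 0" if "0 \<le> y" for y
  proof -
    have "H y - H 0 = (\<integral>t. indicator {0..y} t *\<^sub>R H' t \<partial>lborel)"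
      using set_lebesgue_integral_deriv[OF deriv H' that] by simp
    also have "\<dots> = (\<integral>t. indicator {..y} t *\<^sub>R H' t - indicator {..0} t *\<^sub>R H' t \<partial>lborel)"
      by (intro integral_cong_AE)
        (use that H' AE_lborel_singleton[of 0] in \<open>auto simp: indicator_def\<close>)
    also have "\<dots> = I y - I 0"
      unfolding I_def using H' by (intro Bochner_Integration.integral_diff integrable_mult_indicator) auto
    finally show ?thesis .
  qed
  define L where "L = H 0 + ((\<integral>t. H' t \<partial>lborel) - I 0)"
  have "((\<lambda>y. H 0 + (I y - I 0)) \<longlongrightarrow> L) at_top"
    unfolding L_def by (intro tendsto_intros I)
  moreover have "\<forall>\<^sub>F y in at_top. H 0 + (I y - I 0) = H y"
    using eventually_ge_at_top[of 0] by eventually_elim (simp flip: ftc)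
  ultimately have lim: "(H \<longlongrightarrow> L) at_top" by (rule Lim_transform_eventually)
  have "L = 0"
  proof (rule ccontr)
    assume "L \<noteq> 0"
    then have "\<forall>\<^sub>F y in at_top. dist (H y) L < \<bar>L\<bar> / 2" using tendstoD[OF lim, of "\<bar>L\<bar> / 2"] by simp
    then obtain N where N: "\<And>y. N \<le> y \<Longrightarrow> dist (H y) L < \<bar>L\<bar> / 2"
      unfolding eventually_at_top_linorder by blast
    have "integrable lborel (indicator {N..} :: real \<Rightarrow> real)"
    proof (rule Bochner_Integration.integrable_bound)
      show "integrable lborel (\<lambda>y. 2 / \<bar>L\<bar> * H y)" using H by simp
      have "1 \<le> \<bar>2 / \<bar>L\<bar> * H y\<bar>" if "N \<le> y" for y
      proof -
        have "\<bar>L\<bar> / 2 \<le> \<bar>H y\<bar>" using N[OF that] unfolding dist_real_def by linarith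
        then show ?thesis using \<open>L \<noteq> 0\<close> by (simp add: abs_mult field_simps)
      qed
      then show "AE y in lborel. norm (indicator {N..} y :: real) \<le> norm (2 / \<bar>L\<bar> * H y)"
        by (intro AE_I2) (auto simp: indicator_def)
    qed simp
    then have fin: "emeasure lborel {N..} < \<infinity>" by (simp add: integrable_indicator_iff)
    obtain m :: nat where m: "emeasure lborel {N..} < ennreal (real m)"
      using fin ennreal_Ex_less_of_nat[of "emeasure lborel {N..}"]
      by (auto simp: ennreal_of_nat_eq_real_of_nat)
    have "ennreal (real m) = emeasure lborel {N..N + real m}" by simp
    also have "\<dots> \<le> emeasure lborel {N..}" by (intro emeasure_mono) auto
    finally show False using m by simp
  qed
  then show ?thesis using lim by simp
qed

lemma integral_deriv_eq_0:
  fixes H H' :: "real \<Rightarrow> real"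
  assumes deriv: "\<And>t. (H has_real_derivative H' t) (at t)"
    and H: "integrable lborel H" and H': "integrable lborel H'"
  shows "(\<integral>t. H' t \<partial>lborel) = 0"
proof -
  \<comment> \<open>The limit at minus infinity is that of the reflected function at
    infinity.\<close>
  have "((\<lambda>t. H (- t)) \<longlongrightarrow> 0) at_top"
  proof (rule tendsto_0_at_top_if_integrable_deriv)
    show "((\<lambda>t. H (- t)) has_real_derivative - H' (- t)) (at t)" for t
      using DERIV_chain2[OF deriv DERIV_minus[OF DERIV_ident]] by simp
    show "integrable lborel (\<lambda>t. H (- t))"
      using lborel_integrable_real_affine[OF H, of "- 1" 0] by simp
    show "integrable lborel (\<lambda>t. - H' (- t))"
      using lborel_integrable_real_affine[OF H', of "- 1" 0] by simp
  qed
  then have "((\<lambda>t. H t - H (- t)) \<longlongrightarrow> 0 - 0) at_top"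
    by (intro tendsto_diff tendsto_0_at_top_if_integrable_deriv[OF deriv H H'])
  then have l0: "((\<lambda>n. H (real n) - H (- real n)) \<longlongrightarrow> 0) sequentially"
    using filterlim_compose[OF _ filterlim_real_sequentially] by auto
  have "(\<lambda>n. \<integral>t. indicator {- real n..real n} t *\<^sub>R H' t \<partial>lborel) \<longlonglongrightarrow> (\<integral>t. H' t \<partial>lborel)"
  proof (rule integral_dominated_convergence)
    show "integrable lborel (\<lambda>t. \<bar>H' t\<bar>)" using H' by simp
    show "AE t in lborel. (\<lambda>n. indicator {- real n..real n} t *\<^sub>R H' t) \<longlonglongrightarrow> H' t"
    proof (intro AE_I2 tendsto_eventually)
      fix t :: real
      obtain N where "\<bar>t\<bar> \<le> real N" using real_arch_simple by blast
      then show "\<forall>\<^sub>F n in sequentially. indicator {- real n..real n} t *\<^sub>R H' t = H' t"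
        unfolding eventually_sequentially by (intro exI[of _ N]) (auto simp: indicator_def)
    qed
  qed (use H' in \<open>auto simp: indicator_def\<close>)
  moreover have "(\<integral>t. indicator {- real n..real n} t *\<^sub>R H' t \<partial>lborel) = H (real n) - H (- real n)" for n
    by (rule set_lebesgue_integral_deriv[OF deriv H']) simp
  ultimately show ?thesis using l0 LIMSEQ_unique by auto
qed

text \<open>
  A \<open>C\<^sup>1\<close> approximation of the identity on the positive half-line.  Because it vanishes near 0,
  its composition with a density stays differentiable across the boundary of the support.
\<close>

definition cutoff :: "real \<Rightarrow> real \<Rightarrow> real"
  where "cutoff e x = (if x \<le> e then 0 else (x - e)\<^sup>2 / x)"

definition cutoff' :: "real \<Rightarrow> real \<Rightarrow> real"
  where "cutoff' e x = (if x \<le> e then 0 else 1 - (e / x)\<^sup>2)"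

text \<open>Both bounds are uniform in \<open>e\<close>, so that the same integrable functions
  dominate at every cut-off level.\<close>

lemma cutoff_bounds:
  assumes "0 < e"
  shows "\<bar>cutoff e x\<bar> \<le> \<bar>x\<bar>" "\<bar>cutoff' e x\<bar> \<le> 1"
proof -
  have "(x - e)\<^sup>2 \<le> x * x" if "e < x"
    using assms that by (simp add: power2_eq_square mult_mono)
  then show "\<bar>cutoff e x\<bar> \<le> \<bar>x\<bar>" using assms by (auto simp: cutoff_def field_simps)
  have "0 \<le> e / x" "e / x \<le> 1" if "e < x" using assms that by auto
  then have "(e / x)\<^sup>2 \<le> 1" if "e < x" using that power_le_one by blast
  then show "\<bar>cutoff' e x\<bar> \<le> 1" by (auto simp: cutoff'_def)
qed

text \<open>Beyond \<open>e\<close> the function is \<open>x - 2 e + e\<^sup>2 / x\<close>, with a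
  double zero at \<open>e\<close>; hence it joins the constant 0 with slope 0. Only at
  \<open>e\<close> itself is the difference quotient estimated directly.\<close>

lemma cutoff_deriv:
  assumes e: "0 < e"
  shows "(cutoff e has_real_derivative cutoff' e x) (at x)"
proof -
  consider "x < e" | "x = e" | "e < x" by linarith
  then show ?thesis
  proof cases
    case 1
    have d: "((\<lambda>_. 0) has_real_derivative cutoff' e x) (at x)" using 1 by (simp add: cutoff'_def)
    have ev: "\<forall>\<^sub>F y in nhds x. 0 = cutoff e y"
      using eventually_nhds_in_open[of "{..<e}" x] 1 by (auto elim!: eventually_mono simp: cutoff_def)
    show ?thesis by (rule iffD1[OF DERIV_cong_ev[OF refl ev refl] d])
  next
    case 2
    have "((\<lambda>y. cutoff e y / (y - e)) \<longlongrightarrow> 0) (at e)"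
    proof (rule Lim_null_comparison)
      show "((\<lambda>y. \<bar>y - e\<bar> / e) \<longlongrightarrow> 0) (at e)"
        using e by (auto intro!: tendsto_eq_intros)
      have "norm (cutoff e y / (y - e)) \<le> \<bar>y - e\<bar> / e" for y
      proof (cases "y \<le> e")
        case False
        then have "cutoff e y / (y - e) = (y - e) / y" by (simp add: cutoff_def power2_eq_square)
        also have "\<dots> \<le> (y - e) / e" using False e by (intro divide_left_mono) auto
        finally show ?thesis using False e by (auto simp: cutoff_def)
      qed (use e in \<open>simp add: cutoff_def\<close>)
      then show "\<forall>\<^sub>F y in at e. norm (cutoff e y / (y - e)) \<le> \<bar>y - e\<bar> / e" by simp
    qed
    then show ?thesis using 2 by (simp add: has_field_derivative_iff cutoff_def[of e e] cutoff'_def)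
  next
    case 3
    then have "x \<noteq> 0" using e by simp
    then have d: "((\<lambda>y. (y - e)\<^sup>2 / y) has_real_derivative cutoff' e x) (at x)"
      using 3 by (auto intro!: derivative_eq_intros simp: cutoff'_def field_simps power2_eq_square)
    have ev: "\<forall>\<^sub>F y in nhds x. (y - e)\<^sup>2 / y = cutoff e y"
      using eventually_nhds_in_open[of "{e<..}" x] 3 by (auto elim!: eventually_mono simp: cutoff_def)
    show ?thesis by (rule iffD1[OF DERIV_cong_ev[OF refl ev refl] d])
  qed
qed

lemma cutoff_tendsto:
  fixes e :: "nat \<Rightarrow> real"
  assumes e: "e \<longlonglongrightarrow> 0" and x: "0 < x"
  shows "(\<lambda>n. cutoff (e n) x) \<longlonglongrightarrow> x" "(\<lambda>n. cutoff' (e n) x) \<longlonglongrightarrow> 1"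
proof -
  have ev: "\<forall>\<^sub>F n in sequentially. e n < x" using e x by (rule order_tendstoD)
  have "(\<lambda>n. (x - e n)\<^sup>2 / x) \<longlonglongrightarrow> (x - 0)\<^sup>2 / x" using x by (intro tendsto_intros e) auto
  then have "(\<lambda>n. (x - e n)\<^sup>2 / x) \<longlonglongrightarrow> x" using x by (simp add: power2_eq_square)
  moreover have "\<forall>\<^sub>F n in sequentially. (x - e n)\<^sup>2 / x = cutoff (e n) x"
    using ev by eventually_elim (simp add: cutoff_def)
  ultimately show "(\<lambda>n. cutoff (e n) x) \<longlonglongrightarrow> x" by (rule Lim_transform_eventually)
  have "(\<lambda>n. 1 - (e n / x)\<^sup>2) \<longlonglongrightarrow> 1 - (0 / x)\<^sup>2" using x by (intro tendsto_intros e) auto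
  then have "(\<lambda>n. 1 - (e n / x)\<^sup>2) \<longlonglongrightarrow> 1" by simp
  moreover have "\<forall>\<^sub>F n in sequentially. 1 - (e n / x)\<^sup>2 = cutoff' (e n) x"
    using ev by eventually_elim (simp add: cutoff'_def)
  ultimately show "(\<lambda>n. cutoff' (e n) x) \<longlonglongrightarrow> 1" by (rule Lim_transform_eventually)
qed

text \<open>Extended by 0 outside \<open>U\<close>, \<open>P\<close> is continuous, hence below
  \<open>e\<close> near every point outside \<open>U\<close>. There \<open>\<phi>\<close> times the
  cut-off of \<open>P\<close> is locally 0, however \<open>\<phi>\<close> behaves. The product is
  thus differentiable on the whole line, its derivative integrates to 0, and dominated convergence
  lets \<open>e\<close> tend to 0.\<close>

lemma integration_by_parts_open:
  fixes P P' \<phi> \<phi>' :: "real \<Rightarrow> real"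
  assumes U: "open U"
    and P: "\<And>t. t \<in> U \<Longrightarrow> (P has_real_derivative P' t) (at t)"
    and \<phi>: "\<And>t. t \<in> U \<Longrightarrow> (\<phi> has_real_derivative \<phi>' t) (at t)"
    and pos: "\<And>t. t \<in> U \<Longrightarrow> 0 < P t"
    and boundary: "\<And>t. t \<notin> U \<Longrightarrow> (P \<longlongrightarrow> 0) (at t within U)"
    and int: "integrable lborel (\<lambda>t. indicator U t * (\<phi> t * P t))"
    and int1: "integrable lborel (\<lambda>t. indicator U t * (\<phi> t * P' t))"
    and int2: "integrable lborel (\<lambda>t. indicator U t * (\<phi>' t * P t))"
  shows "(\<integral>t. indicator U t * (\<phi> t * P' t) + indicator U t * (\<phi>' t * P t) \<partial>lborel) = 0"
proof -
  define P0 where "P0 = (\<lambda>t. if t \<in> U then P t else 0)"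
  have cont: "isCont P0 t" for t
  proof (cases "t \<in> U")
    case True
    have "\<forall>\<^sub>F s in nhds t. P0 s = P s"
      using eventually_nhds_in_open[OF U True] by eventually_elim (simp add: P0_def)
    then show ?thesis using DERIV_isCont[OF P[OF True]] by (simp add: isCont_cong)
  next
    case False
    have "(P0 \<longlongrightarrow> 0) (at t)"
      unfolding P0_def using boundary[OF False]
      by (intro filterlim_at_within_If) (simp_all add: at_within_def)
    then show ?thesis using False by (simp add: isCont_def P0_def)
  qed
  have P0_borel[measurable]: "P0 \<in> borel_measurable borel"
    using cont by (intro borel_measurable_continuous_onI) (auto simp: continuous_on_eq_continuous_at)
  define H where "H = (\<lambda>e t. \<phi> t * cutoff e (P0 t))"
  \<comment> \<open>Written with the ratio of the cut-off to \<open>P0\<close>, both coefficients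
    are at most 1 in modulus, so that \<open>int1\<close> and \<open>int2\<close> dominate. Where
    \<open>P0\<close> is 0 the ratio is 0 by the convention on division.\<close>
  define H' where "H' = (\<lambda>e t. cutoff' e (P0 t) * (indicator U t * (\<phi> t * P' t))
    + cutoff e (P0 t) / P0 t * (indicator U t * (\<phi>' t * P t)))"
  have deriv: "(H e has_real_derivative H' e t) (at t)" if e: "0 < e" for e t
  proof (cases "t \<in> U")
    case True
    have ev: "\<forall>\<^sub>F s in nhds t. \<phi> s * cutoff e (P s) = H e s"
      using eventually_nhds_in_open[OF U True] by eventually_elim (simp add: P0_def H_def)
    have "((\<lambda>s. \<phi> s * cutoff e (P s)) has_real_derivative
        \<phi>' t * cutoff e (P t) + cutoff' e (P t) * P' t * \<phi> t) (at t)"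
      by (rule DERIV_mult[OF \<phi>[OF True] DERIV_chain2[OF cutoff_deriv[OF e] P[OF True]]])
    moreover have "\<phi>' t * cutoff e (P t) + cutoff' e (P t) * P' t * \<phi> t = H' e t"
      using True pos[OF True] by (simp add: H'_def P0_def)
    ultimately show ?thesis using DERIV_cong_ev[OF refl ev refl] by simp
  next
    case False
    have "\<forall>\<^sub>F s in at t. P0 s < e"
      using cont[of t] e False by (intro order_tendstoD(2)[of P0 0]) (auto simp: isCont_def P0_def)
    then have "\<forall>\<^sub>F s in nhds t. P0 s < e"
      using e False by (simp add: eventually_nhds_conv_at P0_def)
    then have ev: "\<forall>\<^sub>F s in nhds t. 0 = H e s"
      by eventually_elim (simp add: H_def cutoff_def)
    have "H' e t = 0" using False e by (simp add: H'_def)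
    then show ?thesis using iffD1[OF DERIV_cong_ev[OF refl ev refl] DERIV_const] by simp
  qed
  have zero: "(\<integral>t. H' e t \<partial>lborel) = 0" if e: "0 < e" for e
  proof (rule integral_deriv_eq_0[OF deriv[OF e]])
    have "H e \<in> borel_measurable borel"
      using DERIV_isCont[OF deriv[OF e]]
      by (intro borel_measurable_continuous_onI) (auto simp: continuous_on_eq_continuous_at)
    moreover have "norm (H e t) \<le> norm (indicator U t * (\<phi> t * P t))" for t
      using e cutoff_bounds(1)[OF e, of "P t"]
      by (auto simp: H_def P0_def abs_mult cutoff_def[of e 0] intro!: mult_left_mono)
    ultimately show "integrable lborel (H e)"
      by (intro Bochner_Integration.integrable_bound[OF int] AE_I2) auto
    have [measurable]: "(\<lambda>t. cutoff e (P0 t)) \<in> borel_measurable borel"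
      "(\<lambda>t. cutoff' e (P0 t)) \<in> borel_measurable borel"
      unfolding cutoff_def cutoff'_def by measurable
    have "integrable lborel (\<lambda>t. cutoff' e (P0 t) * (indicator U t * (\<phi> t * P' t)))"
      using int1 cutoff_bounds(2)[OF e]
      by (intro Bochner_Integration.integrable_bound[OF int1] AE_I2)
        (auto simp: abs_mult intro: mult_left_le_one_le borel_measurable_integrable)
    moreover have "integrable lborel (\<lambda>t. cutoff e (P0 t) / P0 t * (indicator U t * (\<phi>' t * P t)))"
    proof (rule Bochner_Integration.integrable_bound[OF int2])
      have "\<bar>cutoff e (P0 t) / P0 t\<bar> \<le> 1" for t
        using cutoff_bounds(1)[OF e, of "P0 t"] by (cases "P0 t = 0") auto
      from mult_right_mono[OF this abs_ge_zero]
      show "AE t in lborel. norm (cutoff e (P0 t) / P0 t * (indicator U t * (\<phi>' t * P t)))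
          \<le> norm (indicator U t * (\<phi>' t * P t))"
        by (intro AE_I2) (simp only: real_norm_def abs_mult[of "_ / _"] mult_1_left)
    qed (use int2 in measurable)
    ultimately show "integrable lborel (H' e)" unfolding H'_def by (rule Bochner_Integration.integrable_add)
  qed
  have "(\<lambda>n. \<integral>t. H' (1 / real (Suc n)) t \<partial>lborel) \<longlonglongrightarrow>
      (\<integral>t. indicator U t * (\<phi> t * P' t) + indicator U t * (\<phi>' t * P t) \<partial>lborel)"
  proof (rule integral_dominated_convergence)
    show "integrable lborel (\<lambda>t. \<bar>indicator U t * (\<phi> t * P' t)\<bar> + \<bar>indicator U t * (\<phi>' t * P t)\<bar>)"
      using int1 int2 by auto
    have [measurable]: "(\<lambda>t. cutoff e (P0 t)) \<in> borel_measurable borel"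
      "(\<lambda>t. cutoff' e (P0 t)) \<in> borel_measurable borel" for e
      unfolding cutoff_def cutoff'_def by measurable
    show "(\<lambda>t. H' (1 / real (Suc n)) t) \<in> borel_measurable lborel" for n
      unfolding H'_def using int1 int2 by measurable
    show "AE t in lborel. (\<lambda>n. H' (1 / real (Suc n)) t)
        \<longlonglongrightarrow> indicator U t * (\<phi> t * P' t) + indicator U t * (\<phi>' t * P t)"
    proof (rule AE_I2)
      fix t
      show "(\<lambda>n. H' (1 / real (Suc n)) t)
        \<longlonglongrightarrow> indicator U t * (\<phi> t * P' t) + indicator U t * (\<phi>' t * P t)"
      proof (cases "t \<in> U")
        case True
        note lim = cutoff_tendsto[OF LIMSEQ_Suc[OF lim_1_over_n] pos[OF True]]
        have "(\<lambda>n. H' (1 / real (Suc n)) t) \<longlonglongrightarrow> 1 * (indicator U t * (\<phi> t * P' t))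
            + P t / P t * (indicator U t * (\<phi>' t * P t))"
          unfolding H'_def P0_def using True pos[OF True] lim
          by (simp only: if_True) (intro tendsto_intros, auto)
        then show ?thesis using pos[OF True] by simp
      qed (simp add: H'_def)
    qed
    fix n
    have e: "0 < 1 / real (Suc n)" by simp
    have "\<bar>H' (1 / real (Suc n)) t\<bar>
        \<le> \<bar>indicator U t * (\<phi> t * P' t)\<bar> + \<bar>indicator U t * (\<phi>' t * P t)\<bar>" for t
    proof -
      have "\<bar>cutoff (1 / real (Suc n)) (P0 t) / P0 t\<bar> \<le> 1"
        using cutoff_bounds(1)[OF e, of "P0 t"] by (cases "P0 t = 0") auto
      from mult_right_mono[OF this abs_ge_zero] mult_right_mono[OF cutoff_bounds(2)[OF e] abs_ge_zero]
      show ?thesis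
        unfolding H'_def
        by (intro order_trans[OF abs_triangle_ineq] add_mono) (simp_all only: abs_mult[of "_ / _"] abs_mult[of "cutoff' _ _"] mult_1_left)
    qed
    then show "AE t in lborel. norm (H' (1 / real (Suc n)) t)
        \<le> \<bar>indicator U t * (\<phi> t * P' t)\<bar> + \<bar>indicator U t * (\<phi>' t * P t)\<bar>" by simp
  qed (use int1 int2 in auto)
  then show ?thesis using zero by (simp add: LIMSEQ_const_iff)
qed

section \<open>Stein's identity\<close>

lemma fun_upd_in_space: "u \<in> space (Rd_borel d) \<Longrightarrow> j < d \<Longrightarrow> u(j := t) \<in> space (Rd_borel d)"
  by (auto simp: space_PiM PiE_def extensional_def)

lemma space_Rd_borel: "space (Rd_borel d) = topspace (Rd_top d)"
  by (simp add: space_PiM)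

lemma shift_measurable:
  assumes "j < d"
  shows "(\<lambda>u. u(j := u j + c :: real)) \<in> measurable (Rd_borel d) (Rd_borel d)"
  using assms by (intro measurable_fun_upd[where J = "{..<d}"]) auto

lemma score1_eq_gradient:
  assumes "0 < p u" "u \<in> support_interior d p"
    and "((\<lambda>t. p (u(j := t))) has_real_derivative gradient d p p u j) (at (u j))"
  shows "score1 d p u j = - gradient d p p u j / p u"
proof -
  have "((\<lambda>t. ln (p (u(j := t)))) has_real_derivative gradient d p p u j / p u) (at (u j))"
    using DERIV_chain2[OF DERIV_ln assms(3)] assms(1) by (simp add: field_simps)
  then show ?thesis
    using assms(2) by (simp add: score1_def gradient_def partial_deriv_def DERIV_imp_deriv)
qed

section \<open>Densities that vanish at the boundary of their support\<close>

locale regular_density =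
  fixes d :: nat and p :: "(nat \<Rightarrow> real) \<Rightarrow> real"
  assumes nonneg: "\<And>u. 0 \<le> p u"
    and p_borel[measurable]: "p \<in> borel_measurable (Rd_borel d)"
    and pos: "\<And>u. u \<in> support_interior d p \<Longrightarrow> 0 < p u"
    and differentiable: "\<And>u. u \<in> support_interior d p \<Longrightarrow> \<exists>G. has_gradient d p G u UNIV"
    and boundary: "\<And>u. u \<in> Rd_top d frontier_of density_support d p \<Longrightarrow>
      ((\<lambda>v. \<bar>p v\<bar>) \<longlongrightarrow> 0) (atin_within (Rd_top d) u (density_support d p))"
begin

abbreviation "U \<equiv> support_interior d p"
abbreviation "X \<equiv> density_support d p"

lemma openin_U: "openin (Rd_top d) U"
  by (simp add: support_interior_def)

lemma U_sets[measurable]: "U \<in> sets (Rd_borel d)"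
  by (rule openin_Rd_sets[OF openin_U])

lemma openin_compl_X: "openin (Rd_top d) (topspace (Rd_top d) - X)"
  unfolding density_support_def by (intro openin_diff openin_topspace closedin_closure_of)

lemma U_subset_X: "U \<subseteq> X"
  by (simp add: support_interior_def interior_of_subset)

lemma U_topspace: "u \<in> U \<Longrightarrow> u \<in> topspace (Rd_top d)"
  using openin_subset[OF openin_U] by blast

lemma frontier_eq: "Rd_top d frontier_of X = X - U"
  by (simp add: frontier_of_def support_interior_def density_support_def)

lemma support: "u \<in> topspace (Rd_top d) \<Longrightarrow> u \<notin> X \<Longrightarrow> p u = 0"
  using closure_of_subset_Int[of "Rd_top d" "{u. p u \<noteq> 0}"] by (auto simp: density_support_def)

lemma open_line_U: "u \<in> topspace (Rd_top d) \<Longrightarrow> j < d \<Longrightarrow> open {t. u(j := t) \<in> U}"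
  by (rule openin_line[OF openin_U])

lemma line_in_topspace: "u \<in> topspace (Rd_top d) \<Longrightarrow> j < d \<Longrightarrow> u(j := t) \<in> topspace (Rd_top d)"
  using fun_upd_in_space unfolding space_Rd_borel .

text \<open>A line meets \<open>U\<close> in an open set, so a derivative relative to any
  \<open>Y\<close> containing \<open>U\<close> is two-sided at interior points and agrees with the
  partial derivative. \<open>Y\<close> is everything for \<open>p\<close>, but only the support for
  \<open>\<phi>\<close>.\<close>

lemma line_deriv:
  assumes u: "u \<in> topspace (Rd_top d)" "j < d" and t: "u(j := t) \<in> U"
    and grad: "has_gradient d \<phi> G (u(j := t)) Y" and Y: "U \<subseteq> Y"
  shows "((\<lambda>s. \<phi> (u(j := s))) has_real_derivative gradient d p \<phi> (u(j := t)) j) (at t)"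
proof -
  have "((\<lambda>s. \<phi> (u(j := s))) has_real_derivative G j) (at t within {s. u(j := s) \<in> Y})"
    using has_gradient_line[OF grad line_in_topspace[OF u] u(2)] by simp
  then have "((\<lambda>s. \<phi> (u(j := s))) has_real_derivative G j) (at t within {s. u(j := s) \<in> U})"
    using Y by (rule_tac DERIV_subset) auto
  then have *: "((\<lambda>s. \<phi> (u(j := s))) has_real_derivative G j) (at t)"
    using t open_line_U[OF u] by (subst (asm) at_within_open) auto
  then have "gradient d p \<phi> (u(j := t)) j = G j"
    using t by (simp add: gradient_def partial_deriv_def DERIV_imp_deriv)
  then show ?thesis using * by simp
qed

lemma p_line_deriv:
  assumes "u \<in> topspace (Rd_top d)" "j < d" "u(j := t) \<in> U"
  shows "((\<lambda>s. p (u(j := s))) has_real_derivative gradient d p p (u(j := t)) j) (at t)"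
  using differentiable[OF assms(3)] line_deriv[OF assms] by blast

lemma p_deriv:
  "j < d \<Longrightarrow> u \<in> U \<Longrightarrow> ((\<lambda>s. p (u(j := s))) has_real_derivative gradient d p p u j) (at (u j))"
  using p_line_deriv[OF U_topspace, of u j "u j"] by simp

text \<open>A pointwise limit of difference quotients; the indicator of \<open>U\<close> matches the
  value 0 of \<open>gradient\<close> off the interior, so that convergence holds everywhere.\<close>

lemma gradient_borel:
  assumes [measurable]: "\<phi> \<in> borel_measurable (Rd_borel d)" and j: "j < d"
    and deriv: "\<And>u. u \<in> U \<Longrightarrow>
      ((\<lambda>s. \<phi> (u(j := s))) has_real_derivative gradient d p \<phi> u j) (at (u j))"
  shows "(\<lambda>u. gradient d p \<phi> u j) \<in> borel_measurable (Rd_borel d)"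
proof (rule borel_measurable_LIMSEQ_real)
  define h where "h = (\<lambda>n. 1 / real (Suc n))"
  let ?D = "\<lambda>n u. indicator U u * ((\<phi> (u(j := u j + h n)) - \<phi> u) / h n)"
  have h: "h \<longlonglongrightarrow> 0" "\<And>n. h n \<noteq> 0" unfolding h_def by (rule LIMSEQ_Suc[OF lim_1_over_n]) simp
  show "(\<lambda>n. ?D n u) \<longlonglongrightarrow> gradient d p \<phi> u j" for u
  proof (cases "u \<in> U")
    case True
    have "((\<lambda>h. (\<phi> (u(j := u j + h)) - \<phi> u) / h) \<longlongrightarrow> gradient d p \<phi> u j) (at 0)"
      using deriv[OF True] by (simp add: DERIV_def)
    moreover have "filterlim h (at 0) sequentially"
      using h by (simp add: filterlim_at)
    ultimately have "(\<lambda>n. (\<phi> (u(j := u j + h n)) - \<phi> u) / h n) \<longlonglongrightarrow> gradient d p \<phi> u j"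
      by (rule filterlim_compose)
    then show ?thesis using True by simp
  qed (simp add: gradient_def)
  show "?D n \<in> borel_measurable (Rd_borel d)" for n
    using measurable_compose[OF shift_measurable[OF j] assms(1)] by measurable
qed

lemma p_gradient_borel: "j < d \<Longrightarrow> (\<lambda>u. gradient d p p u j) \<in> borel_measurable (Rd_borel d)"
  by (intro gradient_borel p_borel p_deriv)

lemma score1_eq: "j < d \<Longrightarrow> u \<in> U \<Longrightarrow> score1 d p u j = - gradient d p p u j / p u"
  by (intro score1_eq_gradient pos p_deriv)

lemma score1_mult_p: "j < d \<Longrightarrow> score1 d p u j * p u = - gradient d p p u j"
proof (cases "u \<in> U")
  case True
  then show "j < d \<Longrightarrow> ?thesis" using pos[OF True] by (simp add: score1_eq)
qed (simp add: score1_def gradient_def)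

lemma score1_borel[measurable]:
  assumes "j < d"
  shows "(\<lambda>u. score1 d p u j) \<in> borel_measurable (Rd_borel d)"
proof -
  note [measurable] = p_gradient_borel[OF assms]
  have "(\<lambda>u. score1 d p u j) = (\<lambda>u. - gradient d p p u j / p u)"
  proof
    fix u show "score1 d p u j = - gradient d p p u j / p u"
      using assms by (cases "u \<in> U") (auto simp: score1_eq, simp add: score1_def gradient_def)
  qed
  then show ?thesis by simp
qed

text \<open>
  Since \<open>p\<close> tends to 0 at the boundary, on every line the boundary points at which \<open>p\<close> exceeds
  \<open>1/k\<close> are isolated; hence there are only countably many of them.
\<close>

lemma countable_line_boundary:
  assumes u: "u \<in> topspace (Rd_top d)" and j: "j < d"
  shows "countable {t. u(j := t) \<notin> U \<and> p (u(j := t)) \<noteq> 0}"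
proof -
  define T where "T = (\<lambda>k. {t. u(j := t) \<notin> U \<and> 1 / real (Suc k) < p (u(j := t))})"
  have "countable (T k)" for k
  proof (rule no_limpt_imp_countable, rule notI)
    fix z assume limpt: "z islimpt T k"
    let ?z = "u(j := z)"
    have z: "?z \<in> topspace (Rd_top d)" by (rule line_in_topspace[OF u j])
    have "\<exists>S. open S \<and> z \<in> S \<and> (\<forall>t\<in>S. t \<noteq> z \<longrightarrow> t \<notin> T k)"
    proof -
      \<comment> \<open>Near \<open>z\<close>, points of \<open>T k\<close> are excluded by openness
        of \<open>U\<close>, by \<open>p = 0\<close> off the support, or by decay at the frontier.
        The decay is known only within \<open>X\<close>, so the third case treats points off
        \<open>X\<close> separately.\<close>
      consider "?z \<in> U" | "?z \<notin> X" | "?z \<in> X - U" by blast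
      then show ?thesis
      proof cases
        case 1
        then show ?thesis
          using open_line_U[OF u j] by (intro exI[of _ "{t. u(j := t) \<in> U}"]) (auto simp: T_def)
      next
        case 2
        from openin_line[OF openin_compl_X u j] have "open {t. u(j := t) \<notin> X}"
          using line_in_topspace[OF u j] by (simp del: topspace_product_topology)
        moreover have "t \<notin> T k" if "u(j := t) \<notin> X" for t
          using support[OF line_in_topspace[OF u j] that] by (simp add: T_def)
        ultimately show ?thesis using 2 by (intro exI[of _ "{t. u(j := t) \<notin> X}"]) auto
      next
        case 3
        have "((\<lambda>t. \<bar>p (?z(j := t))\<bar>) \<longlongrightarrow> 0) (at (?z j) within {t. ?z(j := t) \<in> X})"
          using filterlim_compose[OF boundary filterlim_line[OF z j]] 3 frontier_eq by auto
        then have "((\<lambda>t. \<bar>p (u(j := t))\<bar>) \<longlongrightarrow> 0) (at z within {t. u(j := t) \<in> X})" by simp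
        then have "\<forall>\<^sub>F t in at z within {t. u(j := t) \<in> X}. \<bar>p (u(j := t))\<bar> < 1 / real (Suc k)"
          by (rule order_tendstoD) simp
        then obtain S where S: "open S" "z \<in> S"
          "\<And>t. t \<in> S \<Longrightarrow> t \<noteq> z \<Longrightarrow> u(j := t) \<in> X \<Longrightarrow> \<bar>p (u(j := t))\<bar> < 1 / real (Suc k)"
          unfolding eventually_at_topological by auto
        have "t \<notin> T k" if "t \<in> S" "t \<noteq> z" for t
        proof (cases "u(j := t) \<in> X")
          case True
          then show ?thesis using S(3)[OF that True] by (auto simp: T_def)
        next
          case False
          then show ?thesis using support[OF line_in_topspace[OF u j] False] by (simp add: T_def)
        qed
        then show ?thesis using S(1,2) by blast
      qed
    qed
    then show False using limpt unfolding islimpt_def by blast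
  qed
  then have "countable (\<Union>k. T k)" by blast
  moreover have "{t. u(j := t) \<notin> U \<and> p (u(j := t)) \<noteq> 0} \<subseteq> (\<Union>k. T k)"
  proof
    fix t assume t: "t \<in> {t. u(j := t) \<notin> U \<and> p (u(j := t)) \<noteq> 0}"
    then have "0 < p (u(j := t))" using nonneg[of "u(j := t)"] by auto
    then obtain k where "inverse (real (Suc k)) < p (u(j := t))" using reals_Archimedean by blast
    then show "t \<in> (\<Union>k. T k)" using t by (auto simp: T_def inverse_eq_divide)
  qed
  ultimately show ?thesis by (rule countable_subset[rotated])
qed

sublocale leb: product_sigma_finite "\<lambda>_ :: nat. lborel :: real measure" ..

lemma insert_dim: "j < d \<Longrightarrow> {..<d} = insert j ({..<d} - {j})"
  by auto

lemma fun_upd_line: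
  assumes "j < d" "v \<in> space (PiM ({..<d} - {j}) (\<lambda>_. lborel :: real measure))"
  shows "v(j := s) \<in> topspace (Rd_top d)" and "(v(j := s))(j := t) = v(j := t)"
  using assms by (auto simp: space_PiM PiE_def extensional_def)

lemma nn_integral_line:
  assumes j: "j < d" and "h \<in> borel_measurable (Rd_borel d)"
  shows "(\<integral>\<^sup>+u. h u \<partial>Rd_lebesgue d)
    = (\<integral>\<^sup>+v. \<integral>\<^sup>+t. h (v(j := t)) \<partial>lborel \<partial>PiM ({..<d} - {j}) (\<lambda>_. lborel))"
proof -
  have "h \<in> borel_measurable (PiM (insert j ({..<d} - {j})) (\<lambda>_. lborel))"
    using assms(2) unfolding insert_dim[OF j, symmetric] measurable_Rd_lebesgue .
  from leb.product_nn_integral_insert[OF _ _ this] show ?thesis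
    unfolding insert_dim[OF j, symmetric] by simp
qed

text \<open>Tonelli along axis 0: every line in this direction meets the exceptional set in
  countably many points. This makes the value 0 given to gradients and scores off the interior
  immaterial.\<close>

lemma AE_interior:
  assumes d: "0 < d"
  shows "AE u in Rd_lebesgue d. u \<notin> U \<longrightarrow> p u = 0"
proof (rule AE_I')
  let ?N = "{u \<in> space (Rd_borel d). u \<notin> U \<and> p u \<noteq> 0}"
  have N: "?N \<in> sets (Rd_borel d)" by measurable
  have "emeasure (Rd_lebesgue d) ?N = (\<integral>\<^sup>+u. indicator ?N u \<partial>Rd_lebesgue d)"
    using N by (simp add: sets_Rd_lebesgue)
  also have "\<dots> = (\<integral>\<^sup>+v. \<integral>\<^sup>+t. indicator ?N (v(0 := t)) \<partial>lborel \<partial>PiM ({..<d} - {0}) (\<lambda>_. lborel))"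
    using d N by (intro nn_integral_line) auto
  also have "\<dots> = (\<integral>\<^sup>+v. 0 \<partial>PiM ({..<d} - {0}) (\<lambda>_. lborel :: real measure))"
  proof (rule nn_integral_cong)
    fix v assume v: "v \<in> space (PiM ({..<d} - {0}) (\<lambda>_. lborel :: real measure))"
    \<comment> \<open>\<open>v\<close> has no coordinate 0. Filling in an arbitrary value makes it a
      point of the space, and the update then overwrites that value.\<close>
    have "countable {t. (v(0 := 0))(0 := t) \<notin> U \<and> p ((v(0 := 0))(0 := t)) \<noteq> 0}"
      by (rule countable_line_boundary[OF fun_upd_line(1)[OF d v] d])
    then have "countable {t. v(0 := t) \<notin> U \<and> p (v(0 := t)) \<noteq> 0}" by simp
    then have c: "{t. v(0 := t) \<notin> U \<and> p (v(0 := t)) \<noteq> 0} \<in> null_sets lborel"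
      by (rule countable_imp_null_set_lborel)
    have "(\<integral>\<^sup>+t. indicator ?N (v(0 := t)) \<partial>lborel) = (\<integral>\<^sup>+t. 0 \<partial>(lborel :: real measure))"
      by (rule nn_integral_cong_AE, rule AE_mp[OF AE_not_in[OF c]]) (auto intro!: AE_I2 simp: indicator_def)
    then show "(\<integral>\<^sup>+t. indicator ?N (v(0 := t)) \<partial>lborel) = 0" by simp
  qed
  finally show "?N \<in> null_sets (Rd_lebesgue d)"
    using N by (simp add: null_sets_def sets_Rd_lebesgue)
  show "{u \<in> space (Rd_lebesgue d). \<not> (u \<notin> U \<longrightarrow> p u = 0)} \<subseteq> ?N"
    by (auto simp: space_PiM)
qed

lemma AE_integrable_line:
  fixes h :: "(nat \<Rightarrow> real) \<Rightarrow> real"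
  assumes j: "j < d" and h: "integrable (Rd_lebesgue d) h"
  shows "AE v in PiM ({..<d} - {j}) (\<lambda>_. lborel). integrable lborel (\<lambda>t. h (v(j := t)))"
proof -
  have h_borel[measurable]: "h \<in> borel_measurable (Rd_borel d)"
    using borel_measurable_integrable[OF h] unfolding measurable_Rd_lebesgue .
  have h': "h \<in> borel_measurable (PiM (insert j ({..<d} - {j})) (\<lambda>_. lborel))"
    using h_borel unfolding insert_dim[OF j, symmetric] measurable_Rd_lebesgue .
  have upd: "(\<lambda>(v, t). v(j := t)) \<in> measurable (PiM ({..<d} - {j}) (\<lambda>_. lborel) \<Otimes>\<^sub>M lborel)
      (PiM (insert j ({..<d} - {j})) (\<lambda>_. lborel :: real measure))"
    by (rule measurable_add_dim)
  have pair: "(\<lambda>(v, t). ennreal \<bar>h (v(j := t))\<bar>)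
      \<in> borel_measurable (PiM ({..<d} - {j}) (\<lambda>_. lborel) \<Otimes>\<^sub>M lborel)"
  proof -
    have [measurable]: "(\<lambda>x. h ((fst x)(j := snd x)))
        \<in> borel_measurable (PiM ({..<d} - {j}) (\<lambda>_. lborel) \<Otimes>\<^sub>M lborel)"
      using measurable_compose[OF upd h'] by (simp add: case_prod_beta')
    show ?thesis unfolding case_prod_beta' by measurable
  qed
  have "(\<integral>\<^sup>+u. ennreal \<bar>h u\<bar> \<partial>Rd_lebesgue d) < \<infinity>"
    using h by (simp add: integrable_iff_bounded)
  then have "(\<integral>\<^sup>+v. \<integral>\<^sup>+t. ennreal \<bar>h (v(j := t))\<bar> \<partial>lborel \<partial>PiM ({..<d} - {j}) (\<lambda>_. lborel)) \<noteq> \<infinity>"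
    by (subst (asm) nn_integral_line[OF j]) auto
  moreover have "(\<lambda>v. \<integral>\<^sup>+t. ennreal \<bar>h (v(j := t))\<bar> \<partial>lborel)
      \<in> borel_measurable (PiM ({..<d} - {j}) (\<lambda>_. lborel))"
    using lborel.borel_measurable_nn_integral[OF pair] by simp
  ultimately have "AE v in PiM ({..<d} - {j}) (\<lambda>_. lborel).
      (\<integral>\<^sup>+t. ennreal \<bar>h (v(j := t))\<bar> \<partial>lborel) \<noteq> \<infinity>"
    by (intro nn_integral_PInf_AE)
  then show ?thesis
  proof (rule AE_mp, intro AE_I2 impI)
    fix v assume v: "v \<in> space (PiM ({..<d} - {j}) (\<lambda>_. lborel :: real measure))"
      and fin: "(\<integral>\<^sup>+t. ennreal \<bar>h (v(j := t))\<bar> \<partial>lborel) \<noteq> \<infinity>"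
    have "(\<lambda>t. h (v(j := t))) \<in> borel_measurable lborel"
      using measurable_compose[OF measurable_compose[OF measurable_Pair1'[OF v] upd] h'] by simp
    then show "integrable lborel (\<lambda>t. h (v(j := t)))"
      using fin by (simp add: integrable_iff_bounded less_top)
  qed
qed

text \<open>Since \<open>score1\<close> times \<open>p\<close> is minus the partial derivative of
  \<open>p\<close>, the two sides differ, line by line, by the integral of the derivative of
  \<open>\<phi> p\<close>. Integrability of \<open>\<phi> p\<close> itself makes this product vanish
  at infinity on almost every line.\<close>

theorem stein_identity:
  assumes j: "j < d"
    and grad: "\<And>u. u \<in> U \<Longrightarrow> \<exists>G. has_gradient d \<phi> G u X"
    and int: "integrable (Rd_lebesgue d) (\<lambda>u. \<phi> u * p u)"
    and int1: "integrable (Rd_lebesgue d) (\<lambda>u. \<phi> u * score1 d p u j * p u)"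
    and int2: "integrable (Rd_lebesgue d) (\<lambda>u. gradient d p \<phi> u j * p u)"
  shows "(\<integral>u. \<phi> u * score1 d p u j * p u \<partial>Rd_lebesgue d) = (\<integral>u. gradient d p \<phi> u j * p u \<partial>Rd_lebesgue d)"
proof -
  have eq1: "\<phi> u * score1 d p u j * p u = - (\<phi> u * gradient d p p u j)" for u
    using score1_mult_p[OF j] by (simp add: mult.assoc)
  have int1': "integrable (Rd_lebesgue d) (\<lambda>u. \<phi> u * gradient d p p u j)"
    using int1 unfolding eq1 by simp
  have intU: "integrable (Rd_lebesgue d) (\<lambda>u. indicator U u * (\<phi> u * p u))"
    using integrable_mult_indicator[OF _ int, of U] U_sets by (simp add: sets_Rd_lebesgue)
  let ?I = "PiM ({..<d} - {j}) (\<lambda>_. lborel :: real measure)"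
  have ind: "gradient d p h u j = indicator U u * gradient d p h u j" for h u
    by (simp add: gradient_def indicator_def)
  have "AE v in ?I. (\<integral>t. \<phi> (v(j := t)) * gradient d p p (v(j := t)) j
      + gradient d p \<phi> (v(j := t)) j * p (v(j := t)) \<partial>lborel) = 0"
    using AE_integrable_line[OF j intU] AE_integrable_line[OF j int1'] AE_integrable_line[OF j int2] AE_space
  proof eventually_elim
    case (elim v)
    define L where "L = {t. v(j := t) \<in> U}"
    have upd: "v(j := s) \<in> topspace (Rd_top d)" "(v(j := s))(j := t) = v(j := t)" for s t
      using fun_upd_line[OF j elim(4)] .
    have L: "indicator L t = (indicator U (v(j := t)) :: real)" for t by (simp add: L_def indicator_def)
    have iL: "indicator L t * (\<phi> (v(j := t)) * gradient d p p (v(j := t)) j) = \<phi> (v(j := t)) * gradient d p p (v(j := t)) j"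
      "indicator L t * (gradient d p \<phi> (v(j := t)) j * p (v(j := t))) = gradient d p \<phi> (v(j := t)) j * p (v(j := t))" for t
      by (auto simp: L_def indicator_def gradient_def)
    have "(\<integral>t. indicator L t * (\<phi> (v(j := t)) * gradient d p p (v(j := t)) j)
        + indicator L t * (gradient d p \<phi> (v(j := t)) j * p (v(j := t))) \<partial>lborel) = 0"
    proof (rule integration_by_parts_open)
      show "open L"
        using open_line_U[OF upd(1)[of 0] j] by (simp add: L_def)
      show "((\<lambda>t. p (v(j := t))) has_real_derivative gradient d p p (v(j := t)) j) (at t)" if "t \<in> L" for t
        using p_line_deriv[OF upd(1)[of 0] j, of t] that by (simp add: L_def)
      show "((\<lambda>t. \<phi> (v(j := t))) has_real_derivative gradient d p \<phi> (v(j := t)) j) (at t)" if t: "t \<in> L" for t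
      proof -
        obtain G where "has_gradient d \<phi> G (v(j := t)) X" using grad t by (auto simp: L_def)
        then show ?thesis
          using line_deriv[OF upd(1)[of 0] j, of t \<phi> G X] t U_subset_X by (simp add: L_def)
      qed
      show "0 < p (v(j := t))" if "t \<in> L" for t using that pos by (simp add: L_def)
      show "((\<lambda>t. p (v(j := t))) \<longlongrightarrow> 0) (at t within L)" if t: "t \<notin> L" for t
      \<comment> \<open>A point of the line outside \<open>L\<close> lies on the frontier, where the
        boundary condition applies, or off the closed support, where \<open>p\<close> vanishes in a
        neighbourhood.\<close>
      proof (cases "v(j := t) \<in> X")
        case True
        let ?z = "v(j := t)"
        have "?z \<in> Rd_top d frontier_of X" using True t by (simp add: frontier_eq L_def)
        from filterlim_compose[OF boundary[OF this] filterlim_line[OF upd(1) j]]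
        have "((\<lambda>s. \<bar>p (v(j := s))\<bar>) \<longlongrightarrow> 0) (at t within {s. v(j := s) \<in> X})" by simp
        then have "((\<lambda>s. p (v(j := s))) \<longlongrightarrow> 0) (at t within {s. v(j := s) \<in> X})"
          by (simp add: tendsto_rabs_zero_iff)
        then show ?thesis by (rule tendsto_within_subset) (use U_subset_X in \<open>auto simp: L_def\<close>)
      next
        case False
        from openin_line[OF openin_compl_X upd(1)[of 0] j] have "open {s. v(j := s) \<notin> X}"
          using upd(1) by (simp del: topspace_product_topology)
        then have "\<forall>\<^sub>F s in at t within L. p (v(j := s)) = 0"
          unfolding eventually_at_topological
          by (intro exI[of _ "{s. v(j := s) \<notin> X}"]) (use False support upd(1) in auto)
        then show ?thesis by (rule tendsto_eventually)
      qed
      show "integrable lborel (\<lambda>t. indicator L t * (\<phi> (v(j := t)) * p (v(j := t))))"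
        using elim(1) by (simp only: L)
      show "integrable lborel (\<lambda>t. indicator L t * (\<phi> (v(j := t)) * gradient d p p (v(j := t)) j))"
        "integrable lborel (\<lambda>t. indicator L t * (gradient d p \<phi> (v(j := t)) j * p (v(j := t))))"
        using elim(2,3) by (simp_all only: iL)
    qed
    then show ?case by (simp only: iL)
  qed
  then have inner: "(\<integral>v. \<integral>t. \<phi> (v(j := t)) * gradient d p p (v(j := t)) j
      + gradient d p \<phi> (v(j := t)) j * p (v(j := t)) \<partial>lborel \<partial>?I) = 0"
    by (rule integral_eq_zero_AE)
  have "integrable (PiM (insert j ({..<d} - {j})) (\<lambda>_. lborel))
      (\<lambda>u. \<phi> u * gradient d p p u j + gradient d p \<phi> u j * p u)"
    using int1' int2 unfolding insert_dim[OF j, symmetric] by (rule Bochner_Integration.integrable_add)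
  from leb.product_integral_insert[OF _ _ this]
  have "(\<integral>u. \<phi> u * gradient d p p u j + gradient d p \<phi> u j * p u \<partial>Rd_lebesgue d) = 0"
    unfolding insert_dim[OF j, symmetric] inner by simp
  then have "(\<integral>u. \<phi> u * gradient d p p u j \<partial>Rd_lebesgue d) + (\<integral>u. gradient d p \<phi> u j * p u \<partial>Rd_lebesgue d) = 0"
    using int1' int2 by simp
  then show ?thesis unfolding eq1 by simp
qed

end

section \<open>Moments in the single index volatility model\<close>

lemma dot_fun_upd:
  assumes "j < d"
  shows "dot d (u(j := s)) v = dot d u v + (s - u j) * v j"
proof -
  have "dot d (u(j := s)) v = (\<Sum>i<d. u i * v i + (if i = j then (s - u j) * v j else 0))"
    unfolding dot_def by (intro sum.cong) (auto simp: algebra_simps)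
  then show ?thesis using assms by (simp add: sum.distrib dot_def)
qed

lemma dot_borel[measurable]: "(\<lambda>u. dot d u v) \<in> borel_measurable (Rd_borel d)"
  unfolding dot_def by measurable

lemma abs_le_norm2: "j < d \<Longrightarrow> \<bar>v j\<bar> \<le> norm2 d v"
  using member_le_L2_set[of "{..<d}" j "\<lambda>j. \<bar>v j\<bar>"] by (simp add: norm2_def L2_set_def)

section \<open>Inequalities for sixth powers\<close>

lemma powr_6_abs: "\<bar>z\<bar> powr 6 = (z :: real) ^ 6"
proof -
  have "\<bar>z\<bar> powr 6 = \<bar>z\<bar> ^ 6" by (cases "z = 0") auto
  then show ?thesis by (simp add: power_even_abs)
qed

text \<open>Serves integrability only, hence the crude constant. The largest modulus
  \<open>m\<close> satisfies \<open>m ^ 3 \<le> 1 + m ^ 6\<close>.\<close>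

lemma abs_prod3_le:
  fixes a b c :: real
  shows "\<bar>a * b * c\<bar> \<le> 1 + a ^ 6 + b ^ 6 + c ^ 6"
proof -
  define m where "m = max \<bar>a\<bar> (max \<bar>b\<bar> \<bar>c\<bar>)"
  have "\<bar>a * b * c\<bar> \<le> m * m * m"
    unfolding abs_mult by (intro mult_mono) (auto simp: m_def)
  also have "\<dots> = m ^ 3" by (simp add: power3_eq_cube)
  also have "\<dots> \<le> 1 + m ^ 6"
  proof -
    have "0 \<le> (m ^ 3 - 1)\<^sup>2 + (m ^ 3)\<^sup>2" by simp
    then have "2 * m ^ 3 \<le> 1 + 2 * (m ^ 3)\<^sup>2" by (simp add: power2_eq_square algebra_simps)
    moreover have "(m ^ 3)\<^sup>2 = m ^ 6" by (simp flip: power_mult)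
    ultimately show ?thesis by linarith
  qed
  also have "m ^ 6 \<le> a ^ 6 + b ^ 6 + c ^ 6"
    using zero_le_even_power[of 6 a] zero_le_even_power[of 6 b] zero_le_even_power[of 6 c]
    by (auto simp: m_def max_def power_even_abs)
  finally show ?thesis by simp
qed

lemma sixth_power_max:
  fixes a b :: real
  shows "(max \<bar>a\<bar> \<bar>b\<bar>) ^ 6 \<le> a ^ 6 + b ^ 6"
  using zero_le_even_power[of 6 a] zero_le_even_power[of 6 b]
  by (auto simp: max_def power_even_abs)

lemma sq_mult_le_max: "\<bar>a\<^sup>2 * b\<bar> \<le> (max \<bar>a\<bar> \<bar>b\<bar>) ^ 3" for a b :: real
proof -
  have "\<bar>a\<^sup>2 * b\<bar> = \<bar>a\<bar> * \<bar>a\<bar> * \<bar>b\<bar>" by (simp add: abs_mult power2_eq_square)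
  also have "\<dots> \<le> max \<bar>a\<bar> \<bar>b\<bar> * max \<bar>a\<bar> \<bar>b\<bar> * max \<bar>a\<bar> \<bar>b\<bar>" by (intro mult_mono) auto
  finally show ?thesis by (simp add: power3_eq_cube)
qed

text \<open>Arithmetic-geometric mean inequality \<open>m \<le> m\<^sup>2 / (2 r) + r / 2\<close>
  for the cube \<open>m\<close> of the larger modulus. Taking expectations with
  \<open>r = sqrt B\<close> gives at most \<open>3/2 sqrt B\<close>, in place of Hoelder's
  inequality.\<close>

lemma sq_mult_le_weighted:
  fixes a b r :: real
  assumes r: "0 < r"
  shows "\<bar>a\<^sup>2 * b\<bar> \<le> (a ^ 6 + b ^ 6) / (2 * r) + r / 2"
proof -
  define m where "m = (max \<bar>a\<bar> \<bar>b\<bar>) ^ 3"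
  have "0 \<le> (m - r)\<^sup>2" by simp
  then have "2 * (m * r) \<le> m\<^sup>2 + r * r" by (simp add: power2_eq_square algebra_simps)
  then have "m \<le> m\<^sup>2 / (2 * r) + r / 2" using r by (simp add: field_simps)
  also have "m\<^sup>2 \<le> a ^ 6 + b ^ 6" using sixth_power_max[of a b] by (simp add: m_def flip: power_mult)
  finally show ?thesis using r sq_mult_le_max[of a b] by (simp add: m_def divide_right_mono)
qed

lemma sq_le_sixth: "a\<^sup>2 \<le> 1 + a ^ 6" for a :: real
proof (cases "a\<^sup>2 \<le> 1")
  case False
  then have "a\<^sup>2 \<le> (a\<^sup>2) ^ 3" by (intro self_le_power) auto
  then show ?thesis by (simp flip: power_mult)
qed (auto intro: order_trans[of _ 1])

lemma abs_truncate_le: "0 \<le> \<tau> \<Longrightarrow> \<bar>truncate \<tau> v\<bar> \<le> \<tau>"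
  by (simp add: truncate_def)

lemma abs_truncate_le_abs: "\<bar>truncate \<tau> v\<bar> \<le> \<bar>v\<bar>"
  by (simp add: truncate_def)

lemma truncate_borel[measurable]: "truncate \<tau> \<in> borel_measurable borel"
  unfolding truncate_def by measurable

text \<open>The product is left unchanged, or it becomes 0 because one factor exceeds
  \<open>\<tau>\<close>. In the second case the larger modulus \<open>m\<close> exceeds
  \<open>\<tau>\<close>, and \<open>m ^ 3 \<le> m ^ 6 / \<tau> ^ 3\<close> charges the lost cube to
  a sixth moment. This is the origin of the bias.\<close>

lemma truncated_product_bounds:
  fixes a b \<tau> :: real
  assumes \<tau>: "0 < \<tau>"
  defines "t \<equiv> (truncate \<tau> a)\<^sup>2 * truncate \<tau> b"
  shows "\<bar>t\<bar> \<le> \<tau> ^ 3" and "t\<^sup>2 \<le> a ^ 6 + b ^ 6" and "\<bar>t - a\<^sup>2 * b\<bar> \<le> (a ^ 6 + b ^ 6) / \<tau> ^ 3"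
proof -
  have le: "\<bar>t\<bar> \<le> (max \<bar>truncate \<tau> a\<bar> \<bar>truncate \<tau> b\<bar>) ^ 3"
    unfolding t_def by (rule sq_mult_le_max)
  also have "\<dots> \<le> \<tau> ^ 3" using \<tau> abs_truncate_le[of \<tau>] by (intro power_mono) auto
  finally show "\<bar>t\<bar> \<le> \<tau> ^ 3" .
  have "\<bar>t\<bar> \<le> (max \<bar>a\<bar> \<bar>b\<bar>) ^ 3"
    using abs_truncate_le_abs[of \<tau> a] abs_truncate_le_abs[of \<tau> b]
    by (intro order_trans[OF le] power_mono) (auto simp: max_def)
  from power_mono[OF this abs_ge_zero, of 2]
  have "t\<^sup>2 \<le> (max \<bar>a\<bar> \<bar>b\<bar>) ^ 6" by (simp flip: power_mult)
  then show "t\<^sup>2 \<le> a ^ 6 + b ^ 6" using sixth_power_max[of a b] by linarith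
  show "\<bar>t - a\<^sup>2 * b\<bar> \<le> (a ^ 6 + b ^ 6) / \<tau> ^ 3"
  proof (cases "max \<bar>a\<bar> \<bar>b\<bar> \<le> \<tau>")
    case True
    then have "t = a\<^sup>2 * b" by (simp add: t_def truncate_def)
    then show ?thesis using \<tau> by simp
  next
    case False
    define m where "m = max \<bar>a\<bar> \<bar>b\<bar>"
    have "t = 0" using False by (auto simp: t_def truncate_def max_def split: if_splits)
    then have "\<bar>t - a\<^sup>2 * b\<bar> \<le> m ^ 3" using sq_mult_le_max[of a b] by (simp add: m_def)
    also have "\<dots> \<le> m ^ 6 / \<tau> ^ 3"
    proof -
      have "m ^ 3 * \<tau> ^ 3 \<le> m ^ 3 * m ^ 3"
        using False \<tau> by (intro mult_left_mono power_mono) (auto simp: m_def)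
      also have "\<dots> = m ^ 6" by (simp flip: power_add)
      finally show ?thesis using \<tau> by (simp add: field_simps)
    qed
    also have "\<dots> \<le> (a ^ 6 + b ^ 6) / \<tau> ^ 3"
      using \<tau> sixth_power_max[of a b] by (intro divide_right_mono) (auto simp: m_def)
    finally show ?thesis .
  qed
qed

text \<open>After composition both variables are real, the setting of \<open>indep_var\<close>.
  Their preimages are among those of \<open>X\<close> and \<open>Y\<close> and are closed under
  intersection, so independence extends to the generated sigma-algebras.\<close>

lemma independent_rvs_integral_mult:
  fixes h :: "'b \<Rightarrow> real" and k :: "'c \<Rightarrow> real"
  assumes M: "prob_space M" and indep: "independent_rvs M S X T Y"
    and [measurable]: "h \<in> borel_measurable S" "k \<in> borel_measurable T"
    and int: "integrable M (\<lambda>\<omega>. h (X \<omega>))" "integrable M (\<lambda>\<omega>. k (Y \<omega>))"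
  shows "integrable M (\<lambda>\<omega>. h (X \<omega>) * k (Y \<omega>))"
    and "(\<integral>\<omega>. h (X \<omega>) * k (Y \<omega>) \<partial>M) = (\<integral>\<omega>. h (X \<omega>) \<partial>M) * (\<integral>\<omega>. k (Y \<omega>) \<partial>M)"
proof -
  interpret prob_space M by (rule M)
  have [measurable]: "X \<in> measurable M S" "Y \<in> measurable M T"
    and ind: "indep_set {X -` A \<inter> space M |A. A \<in> sets S} {Y -` A \<inter> space M |A. A \<in> sets T}"
    using indep by (auto simp: independent_rvs_def)
  let ?A = "\<lambda>Z. {Z -` A \<inter> space M |A. A \<in> sets (borel :: real measure)}"
  have sub: "?A (\<lambda>\<omega>. q (Z \<omega>)) \<subseteq> {Z -` A \<inter> space M |A. A \<in> sets R}"
    if [measurable]: "q \<in> borel_measurable R" "Z \<in> measurable M R" for q :: "'z \<Rightarrow> real" and Z R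
  proof clarify
    fix A :: "real set" assume "A \<in> sets borel"
    then have "q -` A \<inter> space R \<in> sets R" by measurable
    moreover have "(\<lambda>\<omega>. q (Z \<omega>)) -` A \<inter> space M = Z -` (q -` A \<inter> space R) \<inter> space M"
      using measurable_space[OF that(2)] by auto
    ultimately show "\<exists>A'. (\<lambda>\<omega>. q (Z \<omega>)) -` A \<inter> space M = Z -` A' \<inter> space M \<and> A' \<in> sets R" by blast
  qed
  have stable: "Int_stable (?A Z)" for Z
  proof (rule Int_stableI, clarify)
    fix A A' :: "real set" assume "A \<in> sets borel" "A' \<in> sets borel"
    then show "\<exists>A''. Z -` A \<inter> space M \<inter> (Z -` A' \<inter> space M) = Z -` A'' \<inter> space M \<and> A'' \<in> sets borel"
      by (intro exI[of _ "A \<inter> A'"]) auto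
  qed
  have "indep_set (?A (\<lambda>\<omega>. h (X \<omega>))) (?A (\<lambda>\<omega>. k (Y \<omega>)))"
  proof -
    have "?A (\<lambda>\<omega>. h (X \<omega>)) \<subseteq> {X -` A \<inter> space M |A. A \<in> sets S}"
      "?A (\<lambda>\<omega>. k (Y \<omega>)) \<subseteq> {Y -` A \<inter> space M |A. A \<in> sets T}"
      by (rule sub; measurable)+
    then show ?thesis
      unfolding indep_set_def
      by (intro indep_sets_mono_sets[OF ind[unfolded indep_set_def]]) (simp split: bool.split)
  qed
  from indep_set_sigma_sets[OF this stable stable]
  have "indep_var borel (\<lambda>\<omega>. h (X \<omega>)) borel (\<lambda>\<omega>. k (Y \<omega>))"
    unfolding indep_var_eq by simp
  with int show "integrable M (\<lambda>\<omega>. h (X \<omega>) * k (Y \<omega>))"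
    and "(\<integral>\<omega>. h (X \<omega>) * k (Y \<omega>) \<partial>M) = (\<integral>\<omega>. h (X \<omega>) \<partial>M) * (\<integral>\<omega>. k (Y \<omega>) \<partial>M)"
    by (auto intro: indep_var_integrable indep_var_lebesgue_integral)
qed

section \<open>The model under a sixth-moment bound\<close>

locale regular_volatility = single_index_volatility +
  fixes B :: real
  assumes regular_f: "first_order_regular M d p x (\<lambda>u. (f (dot d u \<beta>))\<^sup>2)"
    and regular_g: "first_order_regular M d p x (\<lambda>u. (g (dot d u \<gamma>))\<^sup>2)"
    and moments: "finite_moment_assumption M d p x \<epsilon> y f g \<beta> \<gamma> 6 B 1"
begin

lemma p_measurable: "p \<in> borel_measurable (Rd_borel d)"
proof -
  have "(\<lambda>u. ennreal (p u)) \<in> borel_measurable (Rd_lebesgue d)"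
    using x_density by (simp add: distributed_def)
  then have "(\<lambda>u. enn2real (ennreal (p u))) \<in> borel_measurable (Rd_lebesgue d)" by measurable
  then show ?thesis using density_nonneg by (simp add: measurable_Rd_lebesgue)
qed

sublocale regular_density d p
  using regular_f by unfold_locales (auto simp: density_nonneg p_measurable first_order_regular_def)

lemma x_measurable[measurable]: "x \<in> measurable M (Rd_borel d)"
  using x_\<epsilon>_indep by (simp add: independent_rvs_def)

lemma \<epsilon>_measurable[measurable]: "\<epsilon> \<in> borel_measurable M"
  using x_\<epsilon>_indep by (simp add: independent_rvs_def)

lemmas [measurable] = f_borel f'_borel g_borel g'_borel

lemma y_measurable[measurable]: "y \<in> borel_measurable M"
proof -
  have "(\<lambda>\<omega>. f (dot d (x \<omega>) \<beta>) + g (dot d (x \<omega>) \<gamma>) * \<epsilon> \<omega>) \<in> borel_measurable M" by measurable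
  then show ?thesis by (subst measurable_cong[OF y_model])
qed

lemma d_pos: "0 < d"
  by (rule unit_dim_pos[OF \<beta>_unit])

lemma B_pos: "0 < B"
  using moments by (simp add: finite_moment_assumption_def)

definition sixth :: "('a \<Rightarrow> real) \<Rightarrow> bool"
  where "sixth Z \<longleftrightarrow> Z \<in> borel_measurable M \<and> integrable M (\<lambda>\<omega>. Z \<omega> ^ 6) \<and> expectation (\<lambda>\<omega>. Z \<omega> ^ 6) \<le> B"

lemma sixth_model:
  "sixth y" "sixth (\<lambda>\<omega>. f (dot d (x \<omega>) \<beta>))" "sixth (\<lambda>\<omega>. g (dot d (x \<omega>) \<gamma>))"
  and sixth_score: "j < d \<Longrightarrow> sixth (\<lambda>\<omega>. score1 d p (x \<omega>) j)"
  using moments unfolding finite_moment_assumption_def moment_le_def sixth_def powr_6_abs by simp_all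

lemma sixth_prod_integrable:
  assumes "sixth Y" "sixth Z" "sixth W"
  shows "integrable M (\<lambda>\<omega>. Y \<omega> * Z \<omega> * W \<omega>)"
proof (rule Bochner_Integration.integrable_bound)
  show "integrable M (\<lambda>\<omega>. 1 + Y \<omega> ^ 6 + Z \<omega> ^ 6 + W \<omega> ^ 6)"
    using assms by (simp add: sixth_def)
  show "AE \<omega> in M. norm (Y \<omega> * Z \<omega> * W \<omega>) \<le> norm (1 + Y \<omega> ^ 6 + Z \<omega> ^ 6 + W \<omega> ^ 6)"
    unfolding real_norm_def by (intro AE_I2 order_trans[OF abs_prod3_le abs_ge_self])
qed (use assms in \<open>auto simp: sixth_def\<close>)

lemma sixth_sq_mult_integrable:
  "sixth Y \<Longrightarrow> sixth Z \<Longrightarrow> integrable M (\<lambda>\<omega>. (Y \<omega>)\<^sup>2 * Z \<omega>)"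
  using sixth_prod_integrable[of Y Y Z] by (simp add: power2_eq_square)

lemma sixth_sq_mult_bound:
  assumes Y: "sixth Y" and Z: "sixth Z"
  shows "\<bar>expectation (\<lambda>\<omega>. (Y \<omega>)\<^sup>2 * Z \<omega>)\<bar> \<le> 2 * sqrt B"
proof -
  have r: "0 < sqrt B" using B_pos by simp
  note int = Y[unfolded sixth_def] Z[unfolded sixth_def]
  have "\<bar>expectation (\<lambda>\<omega>. (Y \<omega>)\<^sup>2 * Z \<omega>)\<bar> \<le> expectation (\<lambda>\<omega>. \<bar>(Y \<omega>)\<^sup>2 * Z \<omega>\<bar>)"
    by (rule integral_abs_bound)
  also have "\<dots> \<le> expectation (\<lambda>\<omega>. (Y \<omega> ^ 6 + Z \<omega> ^ 6) / (2 * sqrt B) + sqrt B / 2)"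
    using int sixth_sq_mult_integrable[OF Y Z] sq_mult_le_weighted[OF r]
    by (intro integral_mono) auto
  also have "\<dots> = (expectation (\<lambda>\<omega>. Y \<omega> ^ 6) + expectation (\<lambda>\<omega>. Z \<omega> ^ 6)) / (2 * sqrt B) + sqrt B / 2"
    using int by (simp add: prob_space)
  also have "\<dots> \<le> (B + B) / (2 * sqrt B) + sqrt B / 2"
    using int r by (intro add_mono divide_right_mono) auto
  also have "\<dots> = B / sqrt B + sqrt B / 2" using r by (simp add: field_simps)
  also have "\<dots> \<le> 2 * sqrt B" using r B_pos by (simp add: real_div_sqrt)
  finally show ?thesis .
qed

lemma AE_x_interior: "AE \<omega> in M. x \<omega> \<in> U"
proof -
  have "AE u in Rd_lebesgue d. 0 < ennreal (p u) \<longrightarrow> u \<in> U"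
    using AE_interior[OF d_pos] by eventually_elim auto
  moreover have "Measurable.pred (Rd_lebesgue d) (\<lambda>u. u \<in> U)"
    unfolding measurable_Rd_lebesgue by measurable
  ultimately show ?thesis using distributed_AE2[OF x_density] by blast
qed

lemma integrable_density_iff:
  fixes h :: "(nat \<Rightarrow> real) \<Rightarrow> real"
  assumes "h \<in> borel_measurable (Rd_borel d)"
  shows "integrable (Rd_lebesgue d) (\<lambda>u. h u * p u) \<longleftrightarrow> integrable M (\<lambda>\<omega>. h (x \<omega>))"
    and "(\<integral>u. h u * p u \<partial>Rd_lebesgue d) = expectation (\<lambda>\<omega>. h (x \<omega>))"
  using distributed_integrable[OF x_density, of h] distributed_integral[OF x_density, of h]
    assms density_nonneg by (simp_all add: measurable_Rd_lebesgue mult.commute)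

text \<open>The derivative of \<open>h\<close> is given only relative to the index values on the
  support. The chain rule is therefore applied within the part of the line inside \<open>U\<close>,
  whose index values are among them; openness of that part makes the result two-sided.\<close>

lemma index_gradient:
  assumes j: "j < d" and u: "u \<in> U"
    and h: "\<And>t. t \<in> (\<lambda>u. dot d u v) ` X \<Longrightarrow> (h has_real_derivative h' t) (at t within (\<lambda>u. dot d u v) ` X)"
  shows "((\<lambda>s. (h (dot d (u(j := s)) v))\<^sup>2) has_real_derivative
      2 * (h (dot d u v) * h' (dot d u v)) * v j) (at (u j))"
    and "gradient d p (\<lambda>u. (h (dot d u v))\<^sup>2) u j = 2 * (h (dot d u v) * h' (dot d u v)) * v j"
proof -
  let ?L = "{s. u(j := s) \<in> U}"
  let ?k = "\<lambda>s. dot d (u(j := s)) v"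
  have L: "open ?L" "u j \<in> ?L" using open_line_U[OF U_topspace[OF u] j] u by auto
  have "(h has_real_derivative h' (?k (u j))) (at (?k (u j)) within ?k ` ?L)"
    by (rule DERIV_subset[OF h]) (use u U_subset_X in auto)
  moreover have "(?k has_real_derivative v j) (at (u j) within ?L)"
    unfolding dot_fun_upd[OF j] by (auto intro!: derivative_eq_intros)
  ultimately have "((h \<circ> ?k) has_real_derivative h' (?k (u j)) * v j) (at (u j) within ?L)"
    by (rule DERIV_image_chain)
  then have "((\<lambda>s. h (?k s)) has_real_derivative h' (dot d u v) * v j) (at (u j))"
    using L unfolding o_def by (simp only: at_within_open fun_upd_triv)
  from DERIV_power[OF this, of 2]
  show 1: "((\<lambda>s. (h (?k s))\<^sup>2) has_real_derivative
      2 * (h (dot d u v) * h' (dot d u v)) * v j) (at (u j))"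
    by (simp add: mult_ac)
  show "gradient d p (\<lambda>u. (h (dot d u v))\<^sup>2) u j = 2 * (h (dot d u v) * h' (dot d u v)) * v j"
    using u DERIV_imp_deriv[OF 1] by (simp add: gradient_def partial_deriv_def)
qed

text \<open>The gradient of the squared link points in the direction \<open>v\<close>, so its mean
  is a multiple of \<open>v\<close>; the 2 is that of differentiating a square. The sixth moments
  and the regularity condition supply the three integrability conditions of Stein's
  identity.\<close>

lemma stein_index:
  assumes j: "j < d"
    and [measurable]: "h \<in> borel_measurable borel" "h' \<in> borel_measurable borel"
    and h: "\<And>t. t \<in> (\<lambda>u. dot d u v) ` X \<Longrightarrow> (h has_real_derivative h' t) (at t within (\<lambda>u. dot d u v) ` X)"
    and reg: "first_order_regular M d p x (\<lambda>u. (h (dot d u v))\<^sup>2)"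
    and sixth: "sixth (\<lambda>\<omega>. h (dot d (x \<omega>) v))"
  shows "expectation (\<lambda>\<omega>. (h (dot d (x \<omega>) v))\<^sup>2 * score1 d p (x \<omega>) j) = 2 * mean_fun_deriv M d x h h' v * v j"
proof -
  let ?\<phi> = "\<lambda>u. (h (dot d u v))\<^sup>2"
  note [measurable] = score1_borel[OF j]
  have grad_borel: "(\<lambda>u. gradient d p ?\<phi> u j) \<in> borel_measurable (Rd_borel d)"
  proof -
    have "(\<lambda>u. gradient d p ?\<phi> u j) = (\<lambda>u. indicator U u * (2 * (h (dot d u v) * h' (dot d u v)) * v j))"
    proof
      fix u show "gradient d p ?\<phi> u j = indicator U u * (2 * (h (dot d u v) * h' (dot d u v)) * v j)"
        using index_gradient(2)[OF j _ h] by (cases "u \<in> U") (simp_all, simp add: gradient_def)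
    qed
    then show ?thesis by simp
  qed
  have grad_int: "integrable M (\<lambda>\<omega>. gradient d p ?\<phi> (x \<omega>) j)"
  proof (rule Bochner_Integration.integrable_bound)
    show "integrable M (\<lambda>\<omega>. norm2 d (gradient d p ?\<phi> (x \<omega>)))"
      using reg by (simp add: first_order_regular_def)
    show "AE \<omega> in M. norm (gradient d p ?\<phi> (x \<omega>) j) \<le> norm (norm2 d (gradient d p ?\<phi> (x \<omega>)))"
      unfolding real_norm_def by (intro AE_I2 order_trans[OF abs_le_norm2[OF j] abs_ge_self])
    show "(\<lambda>\<omega>. gradient d p ?\<phi> (x \<omega>) j) \<in> borel_measurable M"
      by (rule measurable_compose[OF x_measurable grad_borel])
  qed
  have int: "integrable M (\<lambda>\<omega>. ?\<phi> (x \<omega>))"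
  proof (rule Bochner_Integration.integrable_bound)
    show "integrable M (\<lambda>\<omega>. 1 + h (dot d (x \<omega>) v) ^ 6)" using sixth by (simp add: sixth_def)
    show "AE \<omega> in M. norm (?\<phi> (x \<omega>)) \<le> norm (1 + h (dot d (x \<omega>) v) ^ 6)"
    proof (rule AE_I2)
      fix \<omega>
      have "(h (dot d (x \<omega>) v))\<^sup>2 \<le> 1 + h (dot d (x \<omega>) v) ^ 6" by (rule sq_le_sixth)
      then show "norm (?\<phi> (x \<omega>)) \<le> norm (1 + h (dot d (x \<omega>) v) ^ 6)" by simp
    qed
  qed measurable
  have "expectation (\<lambda>\<omega>. ?\<phi> (x \<omega>) * score1 d p (x \<omega>) j)
      = (\<integral>u. ?\<phi> u * score1 d p u j * p u \<partial>Rd_lebesgue d)"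
    by (intro integrable_density_iff(2)[symmetric]) measurable
  also have "\<dots> = (\<integral>u. gradient d p ?\<phi> u j * p u \<partial>Rd_lebesgue d)"
  proof (rule stein_identity[OF j])
    show "\<exists>G. has_gradient d ?\<phi> G u X" if "u \<in> U" for u
      using reg that U_subset_X unfolding first_order_regular_def by blast
    show "integrable (Rd_lebesgue d) (\<lambda>u. ?\<phi> u * p u)"
      using int by (subst integrable_density_iff) measurable
    show "integrable (Rd_lebesgue d) (\<lambda>u. ?\<phi> u * score1 d p u j * p u)"
      using sixth_sq_mult_integrable[OF sixth sixth_score[OF j]] by (subst integrable_density_iff) measurable
    show "integrable (Rd_lebesgue d) (\<lambda>u. gradient d p ?\<phi> u j * p u)"
      using grad_int grad_borel by (subst integrable_density_iff)
  qed
  also have "\<dots> = expectation (\<lambda>\<omega>. gradient d p ?\<phi> (x \<omega>) j)"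
    by (rule integrable_density_iff(2)[OF grad_borel])
  \<comment> \<open>Off the interior \<open>gradient\<close> is 0 by convention while the formula
    need not be, so the two integrands agree only almost surely.\<close>
  also have "\<dots> = expectation (\<lambda>\<omega>. 2 * (h (dot d (x \<omega>) v) * h' (dot d (x \<omega>) v)) * v j)"
  proof (rule integral_cong_AE)
    show "AE \<omega> in M. gradient d p ?\<phi> (x \<omega>) j = 2 * (h (dot d (x \<omega>) v) * h' (dot d (x \<omega>) v)) * v j"
      using AE_x_interior by eventually_elim (rule index_gradient(2)[OF j _ h])
  qed (use grad_int in measurable)
  also have "\<dots> = 2 * mean_fun_deriv M d x h h' v * v j"
    by (simp add: mean_fun_deriv_def)
  finally show ?thesis .
qed

definition \<eta>\<^sub>1 :: real where "\<eta>\<^sub>1 = mean_fun_deriv M d x f f' \<beta>"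
definition \<mu>\<^sub>1 :: real where "\<mu>\<^sub>1 = mean_fun_deriv M d x g g' \<gamma>"
definition w :: "nat \<Rightarrow> real" where "w j = 2 * \<eta>\<^sub>1 * \<beta> j + 2 * \<mu>\<^sub>1 * \<gamma> j"

lemma g_sq_score: "j < d \<Longrightarrow> expectation (\<lambda>\<omega>. (g (dot d (x \<omega>) \<gamma>))\<^sup>2 * score1 d p (x \<omega>) j) = 2 * \<mu>\<^sub>1 * \<gamma> j"
  unfolding \<mu>\<^sub>1_def by (intro stein_index g_borel g'_borel g_deriv regular_g sixth_model)

lemma f_sq_score: "j < d \<Longrightarrow> expectation (\<lambda>\<omega>. (f (dot d (x \<omega>) \<beta>))\<^sup>2 * score1 d p (x \<omega>) j) = 2 * \<eta>\<^sub>1 * \<beta> j"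
  unfolding \<eta>\<^sub>1_def by (intro stein_index f_borel f'_borel f_deriv regular_f sixth_model)

text \<open>In the expansion of the square, independence factors out the moments of
  \<open>\<epsilon>\<close>: the cross term carries the mean 0, the last term the second moment 1.
  Stein's identity evaluates the two remaining terms.\<close>

lemma y_sq_score:
  assumes j: "j < d"
  shows "expectation (\<lambda>\<omega>. (y \<omega>)\<^sup>2 * score1 d p (x \<omega>) j) = w j"
proof -
  note [measurable] = score1_borel[OF j]
  let ?f = "\<lambda>u. f (dot d u \<beta>)" and ?g = "\<lambda>u. g (dot d u \<gamma>)" and ?s = "\<lambda>u. score1 d p u j"
  have int: "integrable M (\<lambda>\<omega>. (?f (x \<omega>))\<^sup>2 * ?s (x \<omega>))"
    "integrable M (\<lambda>\<omega>. ?f (x \<omega>) * ?g (x \<omega>) * ?s (x \<omega>))"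
    "integrable M (\<lambda>\<omega>. (?g (x \<omega>))\<^sup>2 * ?s (x \<omega>))"
    by (intro sixth_sq_mult_integrable sixth_prod_integrable sixth_model sixth_score j)+
  have m1: "(\<lambda>u. ?f u * ?g u * ?s u) \<in> borel_measurable (Rd_borel d)"
    and m2: "(\<lambda>u. (?g u)\<^sup>2 * ?s u) \<in> borel_measurable (Rd_borel d)"
    and m3: "(\<lambda>e :: real. e) \<in> borel_measurable borel" "(\<lambda>e :: real. e\<^sup>2) \<in> borel_measurable borel"
    by measurable
  note lin = independent_rvs_integral_mult[OF prob_space_axioms x_\<epsilon>_indep,
      of "\<lambda>u. ?f u * ?g u * ?s u" "\<lambda>e. e", OF m1 m3(1) int(2) \<epsilon>_integrable]
  note quad = independent_rvs_integral_mult[OF prob_space_axioms x_\<epsilon>_indep,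
      of "\<lambda>u. (?g u)\<^sup>2 * ?s u" "\<lambda>e. e\<^sup>2", OF m2 m3(2) int(3) \<epsilon>_square_integrable]
  have "expectation (\<lambda>\<omega>. (y \<omega>)\<^sup>2 * ?s (x \<omega>)) =
      expectation (\<lambda>\<omega>. (?f (x \<omega>))\<^sup>2 * ?s (x \<omega>) + 2 * (?f (x \<omega>) * ?g (x \<omega>) * ?s (x \<omega>) * \<epsilon> \<omega>)
        + (?g (x \<omega>))\<^sup>2 * ?s (x \<omega>) * (\<epsilon> \<omega>)\<^sup>2)"
  proof (intro Bochner_Integration.integral_cong refl)
    fix \<omega> assume "\<omega> \<in> space M"
    have "(a + b * e)\<^sup>2 * c = a\<^sup>2 * c + 2 * (a * b * c * e) + b\<^sup>2 * c * e\<^sup>2" for a b c e :: real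
      by (simp add: power2_eq_square algebra_simps)
    then show "(y \<omega>)\<^sup>2 * ?s (x \<omega>) = (?f (x \<omega>))\<^sup>2 * ?s (x \<omega>)
        + 2 * (?f (x \<omega>) * ?g (x \<omega>) * ?s (x \<omega>) * \<epsilon> \<omega>) + (?g (x \<omega>))\<^sup>2 * ?s (x \<omega>) * (\<epsilon> \<omega>)\<^sup>2"
      by (simp only: y_model[OF \<open>\<omega> \<in> space M\<close>])
  qed
  also have "\<dots> = expectation (\<lambda>\<omega>. (?f (x \<omega>))\<^sup>2 * ?s (x \<omega>))
      + 2 * expectation (\<lambda>\<omega>. ?f (x \<omega>) * ?g (x \<omega>) * ?s (x \<omega>) * \<epsilon> \<omega>)
      + expectation (\<lambda>\<omega>. (?g (x \<omega>))\<^sup>2 * ?s (x \<omega>) * (\<epsilon> \<omega>)\<^sup>2)"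
    using int(1) lin(1) quad(1)
    by (simp only: Bochner_Integration.integral_add Bochner_Integration.integrable_add
        integrable_mult_right integral_mult_right_zero)
  also have "\<dots> = w j"
    unfolding lin(2) quad(2) f_sq_score[OF j] g_sq_score[OF j] \<epsilon>_mean \<epsilon>_second_moment by (simp add: w_def)
  finally show ?thesis .
qed

lemma w_bound: "j < d \<Longrightarrow> \<bar>w j\<bar> \<le> 2 * sqrt B"
  using sixth_sq_mult_bound[OF sixth_model(1) sixth_score] by (simp add: y_sq_score)

lemma \<gamma>_bound: "j < d \<Longrightarrow> \<bar>2 * \<mu>\<^sub>1 * \<gamma> j\<bar> \<le> 2 * sqrt B"
  using sixth_sq_mult_bound[OF sixth_model(3) sixth_score] by (simp add: g_sq_score)

end

section \<open>Concentration and the main theorem\<close>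

context regular_volatility
begin

lemma w_bar_measurable:
  assumes "\<And>i. i < n \<Longrightarrow> (\<lambda>\<omega>. (xs i \<omega>, ys i \<omega>)) \<in> measurable M (Rd_borel d \<Otimes>\<^sub>M borel)" and j: "j < d"
  shows "(\<lambda>\<omega>. w_bar d n p \<tau> (\<lambda>i. xs i \<omega>) (\<lambda>i. ys i \<omega>) j) \<in> borel_measurable M"
proof -
  note [measurable] = score1_borel[OF j]
  have [measurable]: "xs i \<in> measurable M (Rd_borel d)" "ys i \<in> borel_measurable M" if "i < n" for i
    using measurable_compose[OF assms(1)[OF that] measurable_fst]
      measurable_compose[OF assms(1)[OF that] measurable_snd] by simp_all
  show ?thesis unfolding w_bar_def by measurable
qed

lemma iid_copies_measurable:
  "iid_copies M d n x y xs ys \<Longrightarrow> i < n \<Longrightarrow>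
    (\<lambda>\<omega>. (xs i \<omega>, ys i \<omega>)) \<in> measurable M (Rd_borel d \<Otimes>\<^sub>M borel)"
  by (simp add: iid_copies_def indep_vars_def)

lemma iid_copies_expectation:
  fixes q :: "(nat \<Rightarrow> real) \<times> real \<Rightarrow> real"
  assumes iid: "iid_copies M d n x y xs ys" and i: "i < n"
    and q: "q \<in> borel_measurable (Rd_borel d \<Otimes>\<^sub>M borel)"
  shows "expectation (\<lambda>\<omega>. q (xs i \<omega>, ys i \<omega>)) = expectation (\<lambda>\<omega>. q (x \<omega>, y \<omega>))"
proof -
  have "expectation (\<lambda>\<omega>. q (xs i \<omega>, ys i \<omega>))
      = (\<integral>z. q z \<partial>distr M (Rd_borel d \<Otimes>\<^sub>M borel) (\<lambda>\<omega>. (xs i \<omega>, ys i \<omega>)))"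
    by (rule integral_distr[OF iid_copies_measurable[OF iid i] q, symmetric])
  also have "\<dots> = (\<integral>z. q z \<partial>distr M (Rd_borel d \<Otimes>\<^sub>M borel) (\<lambda>\<omega>. (x \<omega>, y \<omega>)))"
    using iid i by (simp add: iid_copies_def)
  also have "\<dots> = expectation (\<lambda>\<omega>. q (x \<omega>, y \<omega>))"
    by (rule integral_distr[OF _ q]) measurable
  finally show ?thesis .
qed

text \<open>Each factor 2 comes from adding the sixth moments of \<open>y\<close> and of the
  score.\<close>

lemma truncated_score_moments:
  assumes j: "j < d" and \<tau>: "0 < \<tau>"
  defines "t \<equiv> \<lambda>\<omega>. (truncate \<tau> (y \<omega>))\<^sup>2 * truncate \<tau> (score1 d p (x \<omega>) j)"
  shows "expectation (\<lambda>\<omega>. (t \<omega>)\<^sup>2) \<le> 2 * B" and "\<bar>expectation t - w j\<bar> \<le> 2 * B / \<tau> ^ 3"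
proof -
  note [measurable] = score1_borel[OF j]
  let ?s = "\<lambda>\<omega>. score1 d p (x \<omega>) j"
  note sy = sixth_model(1)[unfolded sixth_def] and ss = sixth_score[OF j, unfolded sixth_def]
  have bounds: "\<bar>t \<omega>\<bar> \<le> \<tau> ^ 3" "(t \<omega>)\<^sup>2 \<le> y \<omega> ^ 6 + ?s \<omega> ^ 6"
    "\<bar>t \<omega> - (y \<omega>)\<^sup>2 * ?s \<omega>\<bar> \<le> (y \<omega> ^ 6 + ?s \<omega> ^ 6) / \<tau> ^ 3" for \<omega>
    unfolding t_def by (rule truncated_product_bounds[OF \<tau>])+
  have t[measurable]: "t \<in> borel_measurable M" unfolding t_def by measurable
  have int6: "integrable M (\<lambda>\<omega>. y \<omega> ^ 6 + ?s \<omega> ^ 6)" using sy ss by simp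
  have le6: "expectation (\<lambda>\<omega>. y \<omega> ^ 6 + ?s \<omega> ^ 6) \<le> 2 * B" using sy ss by simp
  have "integrable M (\<lambda>\<omega>. (t \<omega>)\<^sup>2)"
    using bounds(2) by (intro Bochner_Integration.integrable_bound[OF int6] AE_I2) (auto intro: order_trans[OF _ abs_ge_self])
  then have "expectation (\<lambda>\<omega>. (t \<omega>)\<^sup>2) \<le> expectation (\<lambda>\<omega>. y \<omega> ^ 6 + ?s \<omega> ^ 6)"
    using int6 bounds(2) by (intro integral_mono)
  then show "expectation (\<lambda>\<omega>. (t \<omega>)\<^sup>2) \<le> 2 * B" using le6 by linarith
  have int_t: "integrable M t"
    using bounds(1) by (intro integrable_const_bound[where B = "\<tau> ^ 3"] AE_I2) auto
  have int_ys: "integrable M (\<lambda>\<omega>. (y \<omega>)\<^sup>2 * ?s \<omega>)"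
    by (intro sixth_sq_mult_integrable sixth_model sixth_score j)
  have "\<bar>expectation t - w j\<bar> = \<bar>expectation (\<lambda>\<omega>. t \<omega> - (y \<omega>)\<^sup>2 * ?s \<omega>)\<bar>"
    using int_t int_ys y_sq_score[OF j] by simp
  also have "\<dots> \<le> expectation (\<lambda>\<omega>. \<bar>t \<omega> - (y \<omega>)\<^sup>2 * ?s \<omega>\<bar>)" by (rule integral_abs_bound)
  also have "\<dots> \<le> expectation (\<lambda>\<omega>. (y \<omega> ^ 6 + ?s \<omega> ^ 6) / \<tau> ^ 3)"
    using int_t int_ys int6 bounds(3) by (intro integral_mono) auto
  also have "\<dots> = expectation (\<lambda>\<omega>. y \<omega> ^ 6 + ?s \<omega> ^ 6) / \<tau> ^ 3"
    by (rule integral_divide_zero)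
  also have "\<dots> \<le> 2 * B / \<tau> ^ 3"
    using le6 \<tau> by (intro divide_right_mono) auto
  finally show "\<bar>expectation t - w j\<bar> \<le> 2 * B / \<tau> ^ 3" .
qed

text \<open>With \<open>\<tau> ^ 3 = m / r\<close> the summands are bounded by \<open>m / r\<close>
  and the bias \<open>2 B / \<tau> ^ 3\<close> equals \<open>2 m r\<close>, which leaves
  \<open>6 m r\<close> for the fluctuation. At \<open>h = r / m\<close> the quadratic term is
  \<open>n h\<^sup>2 2 B = 2 L\<close> and the level is \<open>6 L\<close>; the difference is the
  exponent \<open>- 4 L\<close>.\<close>

lemma w_bar_concentration:
  assumes j: "j < d" and n: "0 < n" and L: "0 < L" and iid: "iid_copies M d n x y xs ys"
    and \<tau>: "\<tau> = (real n * B / L) powr (1 / 6)"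
  shows "prob {\<omega> \<in> space M. 8 * sqrt B * sqrt (L / real n)
      < \<bar>w_bar d n p \<tau> (\<lambda>i. xs i \<omega>) (\<lambda>i. ys i \<omega>) j - w j\<bar>} \<le> 2 * exp (- 4 * L)"
proof -
  note [measurable] = score1_borel[OF j]
  define m where "m = sqrt B"
  define r where "r = sqrt (L / real n)"
  define h where "h = r / m"
  have m: "0 < m" "B = m\<^sup>2" and r: "0 < r" "L = real n * r\<^sup>2"
    using B_pos L n by (simp_all add: m_def r_def)
  have \<tau>0: "0 < \<tau>" using B_pos L n by (simp add: \<tau>)
  have \<tau>3: "\<tau> ^ 3 = m / r"
  proof -
    have "\<tau> ^ 3 = \<tau> powr 3" using \<tau>0 by simp
    also have "\<dots> = (real n * B / L) powr (1 / 2)" by (simp add: \<tau> powr_powr)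
    also have "\<dots> = sqrt (real n * B / L)" using B_pos L by (intro powr_half_sqrt) simp
    also have "real n * B / L = (m / r)\<^sup>2" using r m n by (simp add: power_divide)
    finally show ?thesis using m r by simp
  qed
  define T where "T = (\<lambda>(u, v). (truncate \<tau> v)\<^sup>2 * truncate \<tau> (score1 d p u j))"
  define Z where "Z = (\<lambda>i \<omega>. T (xs i \<omega>, ys i \<omega>))"
  have T[measurable]: "T \<in> borel_measurable (Rd_borel d \<Otimes>\<^sub>M borel)" unfolding T_def by measurable
  have T_bound: "\<bar>T z\<bar> \<le> m / r" for z
    using truncated_product_bounds(1)[OF \<tau>0] by (simp add: T_def \<tau>3 split: prod.split)
  note mom = truncated_score_moments[OF j \<tau>0, unfolded \<tau>3]
  define E where "E = expectation (\<lambda>\<omega>. T (x \<omega>, y \<omega>))"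
  have EZ: "expectation (Z i) = E" if "i < n" for i
    unfolding Z_def E_def by (rule iid_copies_expectation[OF iid that T])
  have EZ2: "expectation (\<lambda>\<omega>. (Z i \<omega>)\<^sup>2) \<le> 2 * B" if "i < n" for i
    unfolding Z_def
    using iid_copies_expectation[OF iid that, of "\<lambda>z. (T z)\<^sup>2"] mom(1) by (simp add: T_def)
  have Ew: "\<bar>E - w j\<bar> \<le> 2 * m * r"
    using mom(2) m r by (simp add: E_def T_def power2_eq_square)
  have indep: "indep_vars (\<lambda>_. borel) Z {..<n}"
    unfolding Z_def
    by (rule indep_vars_compose2[where Y = "\<lambda>_. T" and M' = "\<lambda>_. Rd_borel d \<Otimes>\<^sub>M borel"])
      (use iid in \<open>auto simp: iid_copies_def\<close>)
  have [measurable]: "Z i \<in> borel_measurable M" if "i < n" for i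
    using indep that by (auto simp: indep_vars_def)
  have W: "w_bar d n p \<tau> (\<lambda>i. xs i \<omega>) (\<lambda>i. ys i \<omega>) j = (\<Sum>i<n. Z i \<omega>) / real n" for \<omega>
    by (simp add: w_bar_def Z_def T_def)
  have "prob {\<omega> \<in> space M. 8 * sqrt B * sqrt (L / real n)
      < \<bar>w_bar d n p \<tau> (\<lambda>i. xs i \<omega>) (\<lambda>i. ys i \<omega>) j - w j\<bar>}
    \<le> prob {\<omega> \<in> space M. 6 * L \<le> \<bar>h * (\<Sum>i<n. Z i \<omega> - expectation (Z i))\<bar>}"
  proof (rule finite_measure_mono, safe)
    fix \<omega>
    define S where "S = (\<Sum>i<n. Z i \<omega>)"
    assume "8 * sqrt B * sqrt (L / real n) < \<bar>w_bar d n p \<tau> (\<lambda>i. xs i \<omega>) (\<lambda>i. ys i \<omega>) j - w j\<bar>"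
    then have "8 * m * r < \<bar>S / real n - w j\<bar>" unfolding W m_def r_def S_def .
    then have dev: "6 * (m * r) < \<bar>S / real n - E\<bar>" using Ew by linarith
    have "6 * L = 6 * (m * r) * (h * real n)"
      using m r by (simp add: h_def power2_eq_square)
    also have "\<dots> \<le> \<bar>S / real n - E\<bar> * (h * real n)"
      using dev m r by (intro mult_right_mono) (auto simp: h_def)
    also have "\<dots> = \<bar>h * (real n * (S / real n - E))\<bar>"
      using m r by (simp add: abs_mult h_def)
    also have "real n * (S / real n - E) = (\<Sum>i<n. Z i \<omega> - expectation (Z i))"
      using n EZ by (simp add: S_def sum_subtractf right_diff_distrib)
    finally show "6 * L \<le> \<bar>h * (\<Sum>i<n. Z i \<omega> - expectation (Z i))\<bar>" .
  qed measurable
  also have "\<dots> \<le> 2 * exp (real n * (h\<^sup>2 * (2 * B)) - 6 * L)"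
  proof (rule bernstein_two_sided[OF indep _ _ EZ2])
    have "r / m * \<bar>T z\<bar> \<le> r / m * (m / r)" for z
      using T_bound m r by (intro mult_left_mono) auto
    then show "\<bar>h * Z i \<omega>\<bar> \<le> 1" for i \<omega> using m r by (simp add: h_def Z_def abs_mult)
    show "h \<noteq> 0" using m r by (simp add: h_def)
  qed
  also have "real n * (h\<^sup>2 * (2 * B)) - 6 * L = - 4 * L"
    using m r by (simp add: h_def power_divide)
  finally show ?thesis .
qed

text \<open>Union bound: \<open>exp (- L)\<close> is \<open>a = \<delta> / (2 d)\<close>, so the
  total is \<open>d * 2 * a ^ 4 = \<delta> * a ^ 3\<close>. Half of \<open>\<delta>\<close> remains
  for the preliminary estimator.\<close>

lemma w_bar_uniform:
  assumes n: "0 < n" and iid: "iid_copies M d n x y xs ys" and \<delta>: "0 < \<delta>" "\<delta> < 1"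
    and \<tau>: "\<tau> = (real n * B / ln (2 * real d / \<delta>)) powr (1 / 6)"
  shows "prob {\<omega> \<in> space M. \<forall>j<d. \<bar>w_bar d n p \<tau> (\<lambda>i. xs i \<omega>) (\<lambda>i. ys i \<omega>) j - w j\<bar>
      \<le> 8 * sqrt B * sqrt (ln (2 * real d / \<delta>) / real n)} \<ge> 1 - \<delta> / 2"
    (is "prob ?G \<ge> _")
proof -
  define L where "L = ln (2 * real d / \<delta>)"
  define a where "a = \<delta> / (2 * real d)"
  have d1: "1 \<le> real d" using d_pos by simp
  have "\<delta> < 2 * real d" using \<delta> d1 by linarith
  then have L: "0 < L" using \<delta> by (simp add: L_def)
  have a: "0 \<le> a" "a \<le> 1 / 2" using \<delta> d1 by (auto simp: a_def field_simps)
  have expL: "exp (- L) = a"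
    using \<delta> d1 by (simp add: L_def a_def exp_minus)
  note [measurable] = w_bar_measurable[OF iid_copies_measurable[OF iid]]
  define bad where "bad = (\<lambda>j. {\<omega> \<in> space M. 8 * sqrt B * sqrt (L / real n)
      < \<bar>w_bar d n p \<tau> (\<lambda>i. xs i \<omega>) (\<lambda>i. ys i \<omega>) j - w j\<bar>})"
  have bad: "bad j \<in> events" if "j < d" for j
    using that unfolding bad_def by measurable
  have "prob (\<Union>j<d. bad j) \<le> (\<Sum>j<d. prob (bad j))"
    using bad by (intro measure_UNION_le) auto
  also have "\<dots> \<le> (\<Sum>j<d. 2 * exp (- 4 * L))"
    unfolding bad_def using w_bar_concentration[OF _ n L iid \<tau>[folded L_def]] by (intro sum_mono) auto
  also have "\<dots> = real d * (2 * a ^ 4)"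
    by (simp add: expL[symmetric] exp_of_nat_mult[symmetric])
  also have "\<dots> = \<delta> * a ^ 3"
    using d1 by (simp add: a_def eval_nat_numeral)
  also have "\<dots> \<le> \<delta> * (1 / 2)"
  proof -
    have "a ^ 3 \<le> a" using a power_decreasing[of 1 3 a] by simp
    then show ?thesis using a \<delta> by (intro mult_left_mono) auto
  qed
  finally have "prob (\<Union>j<d. bad j) \<le> \<delta> / 2" by simp
  moreover have "?G = space M - (\<Union>j<d. bad j)"
    by (auto simp: bad_def L_def not_less)
  ultimately show ?thesis using bad by (simp add: prob_compl sets.finite_UN)
qed

end

theorem theorem3p7:
  fixes K :: real
  assumes "K > 0"
  shows "\<exists>C :: real \<Rightarrow> real \<Rightarrow> real \<Rightarrow> real \<Rightarrow> real.
    \<forall>(M :: 'w measure) d n s p x \<epsilon> y f f' g g' \<beta> \<gamma> xs ys b q Mq c M6 \<eta>1 \<mu>1 \<delta> \<tau> \<kappa> l.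
      single_index_volatility M d p x \<epsilon> y f f' g g' \<beta> \<gamma> \<longrightarrow>
      first_order_regular M d p x (\<lambda>u. (f (dot d u \<beta>))\<^sup>2) \<longrightarrow>
      first_order_regular M d p x (\<lambda>u. (g (dot d u \<gamma>))\<^sup>2) \<longrightarrow>
      norm0 d \<beta> \<le> s \<longrightarrow> norm0 d \<gamma> \<le> s \<longrightarrow>
      dot d \<beta> \<gamma> = 0 \<longrightarrow>
      \<eta>1 = mean_fun_deriv M d x f f' \<beta> \<longrightarrow>
      \<mu>1 = mean_fun_deriv M d x g g' \<gamma> \<longrightarrow> \<mu>1 \<noteq> 0 \<longrightarrow>
      q \<ge> 6 \<longrightarrow> finite_moment_assumption M d p x \<epsilon> y f g \<beta> \<gamma> q Mq c \<longrightarrow>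
      finite_moment_assumption M d p x \<epsilon> y f g \<beta> \<gamma> 6 M6 1 \<longrightarrow>
      n > 0 \<longrightarrow> iid_copies M d n x y xs ys \<longrightarrow>
      independent_rvs M
        (PiM {..<n} (\<lambda>_. Rd_borel d \<Otimes>\<^sub>M borel)) (\<lambda>\<omega>. \<lambda>i\<in>{..<n}. (xs i \<omega>, ys i \<omega>))
        (Rd_borel d) b \<longrightarrow>
      preliminary_estimator M d n s K \<beta> b \<longrightarrow>
      0 < \<delta> \<longrightarrow> \<delta> < 1 \<longrightarrow>
      \<tau> = (real n * M6 / ln (2 * real d / \<delta>)) powr (1 / 6) \<longrightarrow>
      \<kappa> = 14 * sqrt (M6 * ln (2 * real d / \<delta>) / real n) \<longrightarrow>
      l \<ge> C \<eta>1 \<mu>1 (norm1 d \<beta>) (norm1 d \<gamma>) * \<kappa> \<longrightarrow>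
      measure M {\<omega> \<in> space M.
        norm2 d (\<lambda>j. gamma_hat5 d n p \<tau> \<kappa> l (b \<omega>) (\<lambda>i. xs i \<omega>) (\<lambda>i. ys i \<omega>) j - 2 * \<mu>1 * \<gamma> j)
          \<le> 3 * sqrt (real s) * l \<and>
        norm1 d (\<lambda>j. gamma_hat5 d n p \<tau> \<kappa> l (b \<omega>) (\<lambda>i. xs i \<omega>) (\<lambda>i. ys i \<omega>) j - 2 * \<mu>1 * \<gamma> j)
          \<le> 12 * real s * l} \<ge> 1 - \<delta>"
proof (intro exI allI impI)
  define N :: "real \<Rightarrow> real \<Rightarrow> real \<Rightarrow> real \<Rightarrow> real"
    where "N = (\<lambda>\<eta> \<mu> b1 g1. 2 * \<bar>\<eta>\<bar> * b1 + 2 * \<bar>\<mu>\<bar> * g1)"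
  \<comment> \<open>The bound of \<open>projected_deviation_le\<close>, in which \<open>K\<close> is
    the constant fixed beforehand.\<close>
  let ?C = "\<lambda>\<eta> \<mu> b1 g1. 1 + 2 * b1 + K * N \<eta> \<mu> b1 g1 * (2 + K) * g1 / \<bar>\<mu>\<bar>"
  fix M :: "'w measure" and d n s p x \<epsilon> y f f' g g' \<beta> \<gamma> xs ys b q Mq c M6 \<eta>1 \<mu>1 \<delta> \<tau> \<kappa> l
  assume model: "single_index_volatility M d p x \<epsilon> y f f' g g' \<beta> \<gamma>"
    and reg: "first_order_regular M d p x (\<lambda>u. (f (dot d u \<beta>))\<^sup>2)"
      "first_order_regular M d p x (\<lambda>u. (g (dot d u \<gamma>))\<^sup>2)"
    and sparse: "norm0 d \<gamma> \<le> s" and orth: "dot d \<beta> \<gamma> = 0"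
    and \<eta>1: "\<eta>1 = mean_fun_deriv M d x f f' \<beta>" and \<mu>1: "\<mu>1 = mean_fun_deriv M d x g g' \<gamma>"
    and \<mu>0: "\<mu>1 \<noteq> 0"
    and mom: "finite_moment_assumption M d p x \<epsilon> y f g \<beta> \<gamma> 6 M6 1"
    and n: "n > 0" and iid: "iid_copies M d n x y xs ys"
    and ind: "independent_rvs M
        (PiM {..<n} (\<lambda>_. Rd_borel d \<Otimes>\<^sub>M borel)) (\<lambda>\<omega>. \<lambda>i\<in>{..<n}. (xs i \<omega>, ys i \<omega>))
        (Rd_borel d) b"
    and prelim: "preliminary_estimator M d n s K \<beta> b"
    and \<delta>: "0 < \<delta>" "\<delta> < 1"
    and \<tau>: "\<tau> = (real n * M6 / ln (2 * real d / \<delta>)) powr (1 / 6)"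
    and \<kappa>: "\<kappa> = 14 * sqrt (M6 * ln (2 * real d / \<delta>) / real n)"
    and l: "l \<ge> ?C \<eta>1 \<mu>1 (norm1 d \<beta>) (norm1 d \<gamma>) * \<kappa>"
  interpret regular_volatility M d p x \<epsilon> y f f' g g' \<beta> \<gamma> M6
    using model reg mom by (intro regular_volatility.intro regular_volatility_axioms.intro)
  have \<eta>\<mu>: "\<eta>\<^sub>1 = \<eta>1" "\<mu>\<^sub>1 = \<mu>1" by (simp_all add: \<eta>\<^sub>1_def \<mu>\<^sub>1_def \<eta>1 \<mu>1)
  define L where "L = ln (2 * real d / \<delta>)"
  define m where "m = sqrt M6"
  define r where "r = sqrt (L / real n)"
  have "1 \<le> real d" using d_pos by simp
  then have "\<delta> < 2 * real d" using \<delta> by linarith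
  then have L: "0 \<le> L" using \<delta> by (simp add: L_def)
  have m: "0 < m" using B_pos by (simp add: m_def)
  have r: "0 \<le> r" using L by (simp add: r_def)
  have \<kappa>': "\<kappa> = 14 * m * r" by (simp add: \<kappa> m_def r_def L_def flip: real_sqrt_mult)
  define W where "W = (\<lambda>\<omega>. w_bar d n p \<tau> (\<lambda>i. xs i \<omega>) (\<lambda>i. ys i \<omega>))"
  define v where "v = (\<lambda>\<omega> j. W \<omega> j - dot d (b \<omega>) (\<lambda>j. soft_threshold \<kappa> (W \<omega> j)) * b \<omega> j)"
  let ?e = "\<lambda>\<omega> j. gamma_hat5 d n p \<tau> \<kappa> l (b \<omega>) (\<lambda>i. xs i \<omega>) (\<lambda>i. ys i \<omega>) j - 2 * \<mu>1 * \<gamma> j"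
  have e: "?e \<omega> = (\<lambda>j. soft_threshold l (v \<omega> j) - 2 * \<mu>1 * \<gamma> j)" for \<omega>
    by (simp add: gamma_hat5_def w_hat_def[abs_def] v_def W_def)
  define G1 where "G1 = {\<omega> \<in> space M. \<forall>j<d. \<bar>W \<omega> j - w j\<bar> \<le> 8 * sqrt M6 * sqrt (L / real n)}"
  \<comment> \<open>The preliminary bounds at level \<open>\<delta> / 2\<close>; the logarithm is
    then \<open>L\<close>, and the sup-norm bound reads \<open>K r\<close>.\<close>
  define G2 where "G2 = {\<omega> \<in> space M.
      norm2 d (\<lambda>j. b \<omega> j - \<beta> j) \<le> K * sqrt (real s * ln (real d / (\<delta> / 2)) / real n) \<and>
      norm1 d (\<lambda>j. b \<omega> j - \<beta> j) \<le> K * (real s * sqrt (ln (real d / (\<delta> / 2)) / real n)) \<and>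
      norm_inf d (\<lambda>j. b \<omega> j - \<beta> j) \<le> K * sqrt (ln (real d / (\<delta> / 2)) / real n)}"
  have [measurable]: "b \<in> measurable M (Rd_borel d)" using ind by (simp add: independent_rvs_def)
  have b_meas[measurable]: "(\<lambda>\<omega>. b \<omega> j) \<in> borel_measurable M" if "j < d" for j
    using that by (intro measurable_compose[OF \<open>b \<in> measurable M (Rd_borel d)\<close> measurable_component_singleton]) auto
  have W_meas[measurable]: "(\<lambda>\<omega>. W \<omega> j) \<in> borel_measurable M" if "j < d" for j
    unfolding W_def by (rule w_bar_measurable[OF iid_copies_measurable[OF iid] that])
  have [measurable]: "soft_threshold t \<in> borel_measurable borel" for t
    unfolding soft_threshold_def[abs_def] by measurable
  have [measurable]: "(\<lambda>\<omega>. v \<omega> j) \<in> borel_measurable M" if "j < d" for j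
    using that unfolding v_def dot_def by measurable
  have G1: "prob G1 \<ge> 1 - \<delta> / 2"
    using w_bar_uniform[OF n iid \<delta> \<tau>] by (simp add: G1_def W_def L_def)
  have G2: "prob G2 \<ge> 1 - \<delta> / 2"
    using prelim[unfolded preliminary_estimator_def, rule_format, of "\<delta> / 2"] \<delta> by (simp add: G2_def)
  have G1_ev: "G1 \<in> events" unfolding G1_def by measurable
  \<comment> \<open>Measurability follows from the probability bound: \<open>measure\<close> assigns
    0 to a non-measurable set, whereas \<open>1 - \<delta> / 2\<close> is positive.\<close>
  have G2_ev: "G2 \<in> events"
    using G2 \<delta> measure_notin_sets[of G2 M] by auto
  have "prob (G1 \<union> G2) = prob G1 + prob G2 - prob (G1 \<inter> G2)"
    by (rule finite_measure_Union'[OF G1_ev G2_ev, THEN trans]) (simp add: finite_measure_Diff' G1_ev G2_ev Int_commute)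
  then have "1 - \<delta> \<le> prob (G1 \<inter> G2)"
    using G1 G2 prob_le_1[of "G1 \<union> G2"] by simp
  also have "\<dots> \<le> prob {\<omega> \<in> space M. norm2 d (?e \<omega>) \<le> 3 * sqrt (real s) * l \<and> norm1 d (?e \<omega>) \<le> 12 * real s * l}"
  proof (rule finite_measure_mono)
    show "{\<omega> \<in> space M. norm2 d (?e \<omega>) \<le> 3 * sqrt (real s) * l \<and> norm1 d (?e \<omega>) \<le> 12 * real s * l} \<in> events"
      unfolding e norm2_def norm1_def L2_set_def by measurable
    show "G1 \<inter> G2 \<subseteq> {\<omega> \<in> space M. norm2 d (?e \<omega>) \<le> 3 * sqrt (real s) * l \<and> norm1 d (?e \<omega>) \<le> 12 * real s * l}"
    proof
      fix \<omega> assume \<omega>: "\<omega> \<in> G1 \<inter> G2"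
      have close: "\<bar>v \<omega> j - 2 * \<mu>1 * \<gamma> j\<bar> \<le> l" if j: "j < d" for j
      proof -
        have "\<bar>v \<omega> j - 2 * \<mu>1 * \<gamma> j\<bar> \<le> ?C \<eta>1 \<mu>1 (norm1 d \<beta>) (norm1 d \<gamma>) * \<kappa>"
          unfolding v_def
        proof (rule projected_deviation_le[OF m r \<kappa>' assms \<beta>_unit \<gamma>_unit orth \<mu>0 _ _ _ _ _ j])
          show "\<bar>2 * \<eta>1 * \<beta> i + 2 * \<mu>1 * \<gamma> i\<bar> \<le> 2 * m" if "i < d" for i
            using w_bound[OF that] by (simp add: w_def \<eta>\<mu> m_def)
          show "\<bar>2 * \<mu>1 * \<gamma> i\<bar> \<le> 2 * m" if "i < d" for i
            using \<gamma>_bound[OF that] by (simp add: \<eta>\<mu> m_def)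
          show "\<bar>W \<omega> i - (2 * \<eta>1 * \<beta> i + 2 * \<mu>1 * \<gamma> i)\<bar> \<le> 8 * m * r" if "i < d" for i
            using \<omega> that by (simp add: G1_def w_def \<eta>\<mu> m_def r_def)
          show "\<bar>b \<omega> i - \<beta> i\<bar> \<le> K * r" if "i < d" for i
            using \<omega> abs_le_norm_inf[OF that, of "\<lambda>j. b \<omega> j - \<beta> j"]
            by (simp add: G2_def r_def L_def mult.commute)
        qed (simp add: N_def)
        then show ?thesis using l by linarith
      qed
      \<comment> \<open>\<open>l\<close> bounds an absolute value, at an index that exists because
        \<open>d\<close> is positive.\<close>
      have l0: "0 \<le> l" using close[OF d_pos] by linarith
      have "norm0 d (\<lambda>j. 2 * \<mu>1 * \<gamma> j) \<le> s" using sparse \<mu>0 by (simp add: norm0_def)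
      note est = soft_threshold_sparse[of l d "v \<omega>" "\<lambda>j. 2 * \<mu>1 * \<gamma> j", OF l0 close this]
      \<comment> \<open>Soft thresholding gives the factor 2 in both norms, which leaves room in the
        stated 3 and 12.\<close>
      have le: "2 * sqrt (real s) * l \<le> 3 * sqrt (real s) * l" "2 * real s * l \<le> 12 * real s * l"
        using l0 by (intro mult_right_mono; simp)+
      then show "\<omega> \<in> {\<omega> \<in> space M. norm2 d (?e \<omega>) \<le> 3 * sqrt (real s) * l \<and> norm1 d (?e \<omega>) \<le> 12 * real s * l}"
        using \<omega> order_trans[OF est(1) le(1)] order_trans[OF est(2) le(2)] unfolding e by (simp add: G1_def)
    qed
  qed
  finally show "1 - \<delta> \<le> measure M {\<omega> \<in> space M. norm2 d (?e \<omega>) \<le> 3 * sqrt (real s) * l \<and> norm1 d (?e \<omega>) \<le> 12 * real s * l}" .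
qed

end
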